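(* Let $F\in C^2(\Omega)$ and let $u:[t_0,T]\to\mathbb{R}$ be the unique solution of $u'(t)=F(t,u(t))$, $t\in(t_0,T)$, $u(t_0)=u_0$. Suppose that there exist constants $\rho>0$ and $L\ge0$ such that $U_\rho(u)\subset\Omega$ and $|F(t,x)-F(t,y)|\le L|x-y|$ whenever $(t,x),(t,y)\in U_\rho(u)$. Suppose also that there exist constants $H>0$ and $\eta>0$ such that, for every $h\in(0,H]$, a sequence $\{\sigma_n\}_{n=0}^{N_h-1}$ of positive scales (which may depend on $h$) is given such that $\sigma_n^2+u'(t_n)^2\ge\eta$ for every $n=0,1,\ldots,N_h-1$. Then the following hold for the specular ellipse method (SE) with these scales. (a) If $u\in C^3([t_0,T])$, then SE has convergence order 2. (b) If $u\in C^4([t_0,T])$ and $\kappa_{\sigma_n}'(t_n)=0$ whenever $t_{n+1}\le T$, then SE has convergence order 3. (c) If $u\in C^5([t_0,T])$ and $$\left\|\gamma_{\sigma_n}'(t_n)\right\|^3\kappa_{\sigma_n}'(t_n)+\left\|\gamma_{\sigma_n}'(t_{n+1})\right\|^3\kappa_{\sigma_n}'(t_{n+1})=0$$ whenever $t_{n+1}\le T$, then SE has convergence order 4.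
   Context: Let $\Omega\subset\mathbb{R}^2$ be open, $F:\Omega\to\mathbb{R}$, $t_0\ge 0$, $T>t_0$, $u_0\in\mathbb{R}$ with $(t_0,u_0)\in\Omega$. A solution $u:[t_0,T]\to\mathbb{R}$ satisfies $(t,u(t))\in\Omega$ for every $t\in[t_0,T]$. For $\rho>0$, $U_\rho(u):=\{(t,x)\in[t_0,T]\times\mathbb{R}: |x-u(t)|\le\rho\}$. For $h>0$ put $N_h:=\lfloor h^{-1}(T-t_0)\rfloor$ and $t_n:=t_0+nh$. For $\sigma>0$ define $\mathcal{C}_\sigma(\alpha,\beta):=\sigma\,\mathcal{C}(\alpha/\sigma,\beta/\sigma)$, where $$\mathcal{C}(\alpha,\beta):=\left(\frac{\alpha}{\sqrt{1+\alpha^2}}+\frac{\beta}{\sqrt{1+\beta^2}}\right)\left(\frac{1}{\sqrt{1+\alpha^2}}+\frac{1}{\sqrt{1+\beta^2}}\right)^{-1}.$$ The specular ellipse method (SE) with positive scales $\{\sigma_n\}$ is the implicit one-step method $u_{n+1}=u_n+h\,\mathcal{C}_{\sigma_n}(F(t_{n+1},u_{n+1}),F(t_n,u_n))$, $n=0,\ldots,N_h-1$, with $u_0=u(t_0)$. "SE has convergence order $p$" means: there exist constants $h_0\in(0,H]$ and $C>0$ such that, for every $h\in(0,h_0]$, there exists a unique sequence $\{u_n\}_{n=0}^{N_h}$ satisfying the SE update with $\{(t_n,u_n)\}_{n=0}^{N_h}\subseteq U_\rho(u)$, and $\max_{0\le n\le N_h}|u(t_n)-u_n|\le Ch^p$.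 For $\sigma>0$ and $t\in[t_0,T]$: $\gamma_\sigma(t):=(t,u(t)/\sigma)$, so that $\|\gamma_\sigma'(t)\|=\sqrt{1+u'(t)^2/\sigma^2}$ (Euclidean norm), and the signed curvature is $\kappa_\sigma(t):=\dfrac{\sigma^2u''(t)}{(\sigma^2+u'(t)^2)^{3/2}}$; $\kappa_\sigma'$ is its derivative in $t$ (one-sided at the endpoints). *)

theory Defs
  imports "HOL-Analysis.Analysis"
begin

(* C^k via continuous partial derivatives. It is meant for S open, and for S a nondegenerate
   compact interval of the reals; in both cases the derivative within S is unique, and at an
   endpoint of an interval it is the one-sided derivative. *)
primrec Ck_on :: "nat \<Rightarrow> ('a::euclidean_space \<Rightarrow> real) \<Rightarrow> 'a set \<Rightarrow> bool" where
  "Ck_on 0 f S \<longleftrightarrow> continuous_on S f"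
| "Ck_on (Suc k) f S \<longleftrightarrow> f differentiable_on S \<and>
     (\<forall>b\<in>Basis. Ck_on k (\<lambda>x. frechet_derivative f (at x within S) b) S)"

(* Functions on [t0,T] are total functions on the reals of which only the values on [t0,T] matter;
   accordingly every derivative in t is taken within [t0,T], hence one-sided at t0 and T. *)
definition deriv_on :: "real \<Rightarrow> real \<Rightarrow> (real \<Rightarrow> 'a::real_normed_vector) \<Rightarrow> real \<Rightarrow> 'a" where
  "deriv_on t0 T f t = vector_derivative f (at t within {t0..T})"

(* Continuity on the closed interval ties the value at T to the equation on the open interval. *)
definition ivp_solution ::
    "(real \<times> real \<Rightarrow> real) \<Rightarrow> (real \<times> real) set \<Rightarrow> real \<Rightarrow> real \<Rightarrow> real \<Rightarrow> (real \<Rightarrow> real) \<Rightarrow> bool" where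
  "ivp_solution F \<Omega> t0 T u0 u \<longleftrightarrow>
     (\<forall>t\<in>{t0..T}. (t, u t) \<in> \<Omega>) \<and> continuous_on {t0..T} u \<and>
     (\<forall>t\<in>{t0<..<T}. (u has_real_derivative F (t, u t)) (at t)) \<and> u t0 = u0"

definition tube :: "real \<Rightarrow> real \<Rightarrow> (real \<Rightarrow> real) \<Rightarrow> real \<Rightarrow> (real \<times> real) set" where
  "tube t0 T u \<rho> = {(t, x). t \<in> {t0..T} \<and> \<bar>x - u t\<bar> \<le> \<rho>}"

definition num_steps :: "real \<Rightarrow> real \<Rightarrow> real \<Rightarrow> nat" where
  "num_steps t0 T h = nat \<lfloor>inverse h * (T - t0)\<rfloor>"

definition grid :: "real \<Rightarrow> real \<Rightarrow> nat \<Rightarrow> real" where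
  "grid t0 h n = t0 + real n * h"

definition spec_mean :: "real \<Rightarrow> real \<Rightarrow> real" where
  "spec_mean \<alpha> \<beta> =
     (\<alpha> / sqrt (1 + \<alpha>\<^sup>2) + \<beta> / sqrt (1 + \<beta>\<^sup>2)) * inverse (1 / sqrt (1 + \<alpha>\<^sup>2) + 1 / sqrt (1 + \<beta>\<^sup>2))"

definition spec_mean_scaled :: "real \<Rightarrow> real \<Rightarrow> real \<Rightarrow> real" where
  "spec_mean_scaled \<sigma> \<alpha> \<beta> = \<sigma> * spec_mean (\<alpha> / \<sigma>) (\<beta> / \<sigma>)"

(* Only w 0, ..., w (num_steps t0 T h) and \<sigma> 0, ..., \<sigma> (num_steps t0 T h - 1) are constrained. *)
definition SE_sequence ::
    "(real \<times> real \<Rightarrow> real) \<Rightarrow> real \<Rightarrow> real \<Rightarrow> (real \<Rightarrow> real) \<Rightarrow> real \<Rightarrow> (nat \<Rightarrow> real) \<Rightarrow> (nat \<Rightarrow> real) \<Rightarrow> bool" where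
  "SE_sequence F t0 T u h \<sigma> w \<longleftrightarrow> w 0 = u t0 \<and>
     (\<forall>n<num_steps t0 T h.
        w (Suc n) = w n + h * spec_mean_scaled (\<sigma> n) (F (grid t0 h (Suc n), w (Suc n))) (F (grid t0 h n, w n)))"

(* \<sigma> h is the sequence of scales used with step size h. Uniqueness of the finite sequence
   w 0, ..., w (num_steps t0 T h) is agreement at these indices. *)
definition SE_convergence_order ::
    "(real \<times> real \<Rightarrow> real) \<Rightarrow> real \<Rightarrow> real \<Rightarrow> (real \<Rightarrow> real) \<Rightarrow> real \<Rightarrow> real \<Rightarrow> (real \<Rightarrow> nat \<Rightarrow> real) \<Rightarrow> nat \<Rightarrow> bool" where
  "SE_convergence_order F t0 T u \<rho> H \<sigma> p \<longleftrightarrow>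
     (\<exists>h0\<in>{0<..H}. \<exists>C>0. \<forall>h\<in>{0<..h0}.
        let N = num_steps t0 T h;
            admissible = (\<lambda>w. SE_sequence F t0 T u h (\<sigma> h) w \<and>
                              (\<forall>n\<le>N. (grid t0 h n, w n) \<in> tube t0 T u \<rho>))
        in \<exists>w. admissible w \<and> (\<forall>v. admissible v \<longrightarrow> (\<forall>n\<le>N. v n = w n)) \<and>
               (MAX n\<in>{0..N}. \<bar>u (grid t0 h n) - w n\<bar>) \<le> C * h ^ p)"

definition scaled_curve :: "(real \<Rightarrow> real) \<Rightarrow> real \<Rightarrow> real \<Rightarrow> real \<times> real" where
  "scaled_curve u \<sigma> t = (t, u t / \<sigma>)"

definition scaled_curvature :: "real \<Rightarrow> real \<Rightarrow> (real \<Rightarrow> real) \<Rightarrow> real \<Rightarrow> real \<Rightarrow> real" where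
  "scaled_curvature t0 T u \<sigma> t =
     \<sigma>\<^sup>2 * deriv_on t0 T (deriv_on t0 T u) t / (\<sigma>\<^sup>2 + (deriv_on t0 T u t)\<^sup>2) powr (3 / 2)"

end

theory Submission
  imports Defs
begin

text \<open>
  With \<open>A = sqrt (\<sigma>\<^sup>2 + \<alpha>\<^sup>2)\<close> and \<open>B = sqrt (\<sigma>\<^sup>2 + \<beta>\<^sup>2)\<close> the scaled mean is the weighted average
  \<open>(\<alpha> B + \<beta> A) / (A + B) = (\<alpha> + \<beta>) / 2 - (\<alpha> - \<beta>)\<^sup>2 (\<alpha> + \<beta>) / (2 (A + B)\<^sup>2)\<close>.
  The first form is 2-Lipschitz in each argument for every scale, which makes the implicit step a
  contraction and the method stable. The second form exhibits the method as a correction of the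
  trapezoidal rule. By Taylor expansion its local error is, up to higher order terms,
  \<open>- h\<^sup>3 / 24\<close> times the sum over both endpoints of \<open>u''' - 3 u' u''\<^sup>2 / (\<sigma>\<^sup>2 + u'\<^sup>2)\<close>, and this
  expression is the derivative of the curvature multiplied by \<open>\<sigma> \<parallel>\<gamma>'\<parallel>\<^sup>3\<close>.
\<close>

subsection \<open>The scaled specular mean\<close>

text \<open>This is the Euclidean norm of \<open>(s, a)\<close>. If \<open>a\<close> is the slope of
  the solution, it equals \<open>s\<close> times the speed of the scaled curve.\<close>

definition scaled_hyp :: "real \<Rightarrow> real \<Rightarrow> real" where
  "scaled_hyp s a = sqrt (s\<^sup>2 + a\<^sup>2)"

lemma scaled_hyp_pos: "s > 0 \<Longrightarrow> scaled_hyp s a > 0"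
  unfolding scaled_hyp_def by (simp add: add_pos_nonneg)

lemma scaled_hyp_square: "(scaled_hyp s a)\<^sup>2 = s\<^sup>2 + a\<^sup>2"
  unfolding scaled_hyp_def by simp

lemma abs_le_scaled_hyp: "\<bar>a\<bar> \<le> scaled_hyp s a"
  unfolding scaled_hyp_def by (simp add: real_le_rsqrt)

lemma abs_add_le_scaled_hyp: "\<bar>a + b\<bar> \<le> scaled_hyp s a + scaled_hyp s b"
  using abs_le_scaled_hyp[of a s] abs_le_scaled_hyp[of b s] by linarith

text \<open>Reverse triangle inequality in the plane for two points with the same first coordinate;
  hence the constant is free of \<open>s\<close>.\<close>

lemma scaled_hyp_lipschitz: "\<bar>scaled_hyp s a - scaled_hyp s b\<bar> \<le> \<bar>a - b\<bar>"
proof -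
  have "norm (norm (s, a) - norm (s, b)) \<le> norm ((s, a) - (s, b))"
    unfolding real_norm_def by (rule norm_triangle_ineq3)
  then show ?thesis
    by (simp add: scaled_hyp_def norm_Pair)
qed

text \<open>Each root in the mean is \<open>scaled_hyp s x / s\<close>, so clearing denominators
  leaves every argument weighted by the hypotenuse of the other one.\<close>

lemma spec_mean_scaled_eq_weighted:
  assumes "s > 0"
  shows "spec_mean_scaled s a b =
    (a * scaled_hyp s b + b * scaled_hyp s a) / (scaled_hyp s a + scaled_hyp s b)"
proof -
  have root: "sqrt (1 + (x / s)\<^sup>2) = scaled_hyp s x / s" for x
  proof -
    have "1 + (x / s)\<^sup>2 = (s\<^sup>2 + x\<^sup>2) / s\<^sup>2"
      using assms by (simp add: field_simps)
    then show ?thesis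
      using assms by (simp add: scaled_hyp_def real_sqrt_divide)
  qed
  have pos: "scaled_hyp s a > 0" "scaled_hyp s b > 0"
    using assms by (simp_all add: scaled_hyp_pos)
  have "s * ((a / A + b / B) * inverse (s / A + s / B)) = (a * B + b * A) / (A + B)"
    if "A > 0" "B > 0" for A B :: real
  proof -
    have 1: "a / A + b / B = (a * B + b * A) / (A * B)"
      using that by (simp add: field_simps)
    have 2: "s / A + s / B = s * (A + B) / (A * B)"
      using that by (simp add: field_simps)
    show ?thesis
      unfolding 1 2 using that assms by (simp add: divide_simps)
  qed
  from this[OF pos] show ?thesis
    using assms by (simp add: spec_mean_scaled_def spec_mean_def root)
qed

text \<open>The squares of the hypotenuses \<open>A\<close> and \<open>B\<close> differ as those of
  \<open>a\<close> and \<open>b\<close> do, so \<open>(A - B) * (A + B) = (a - b) * (a + b)\<close>.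
  This turns the deviation of the weights from one half into a correction of second order in
  \<open>a - b\<close>.\<close>

lemma spec_mean_scaled_eq_trapezoid:
  assumes "s > 0"
  shows "spec_mean_scaled s a b =
    (a + b) / 2 - (a - b)\<^sup>2 / 2 * ((a + b) / (scaled_hyp s a + scaled_hyp s b)\<^sup>2)"
proof -
  define A B where "A = scaled_hyp s a" and "B = scaled_hyp s b"
  have pos: "A + B > 0"
    unfolding A_def B_def using assms by (simp add: add_pos_pos scaled_hyp_pos)
  have "A\<^sup>2 - B\<^sup>2 = a\<^sup>2 - b\<^sup>2"
    by (simp add: A_def B_def scaled_hyp_square)
  then have diff: "(A - B) * (A + B) = (a - b) * (a + b)"
    by (simp add: algebra_simps power2_eq_square)
  have "2 * (a * B + b * A) * (A + B) = (a + b) * (A + B)\<^sup>2 - (a - b) * ((A - B) * (A + B))"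
    by (simp add: algebra_simps power2_eq_square)
  then have "2 * (a * B + b * A) * (A + B) = (a + b) * (A + B)\<^sup>2 - (a - b)\<^sup>2 * (a + b)"
    unfolding diff by (simp add: algebra_simps power2_eq_square)
  then have "(a * B + b * A) / (A + B) = ((a + b) * (A + B)\<^sup>2 - (a - b)\<^sup>2 * (a + b)) / (2 * (A + B)\<^sup>2)"
    using pos by (simp add: frac_eq_eq power2_eq_square) (simp add: algebra_simps)
  also have "\<dots> = (a + b) / 2 - (a - b)\<^sup>2 / 2 * ((a + b) / (A + B)\<^sup>2)"
    using pos by (simp add: diff_divide_distrib)
  finally show ?thesis
    using assms by (simp add: spec_mean_scaled_eq_weighted A_def B_def)
qed

lemma spec_mean_scaled_commute: "spec_mean_scaled s a b = spec_mean_scaled s b a"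
  by (simp add: spec_mean_scaled_def spec_mean_def add.commute)

text \<open>Over a common denominator every term of the numerator has a factor \<open>a - a'\<close>
  or \<open>A - A'\<close>. The hypotenuses dominate their arguments, so the remaining factors are
  absorbed by \<open>A' + B\<close> and \<open>A + B\<close>, and the scale disappears.\<close>

lemma spec_mean_scaled_lipschitz_left:
  assumes "s > 0"
  shows "\<bar>spec_mean_scaled s a b - spec_mean_scaled s a' b\<bar> \<le> 2 * \<bar>a - a'\<bar>"
proof -
  define A A' B where "A = scaled_hyp s a" and "A' = scaled_hyp s a'" and "B = scaled_hyp s b"
  have pos: "A > 0" "A' > 0" "B > 0"
    unfolding A_def A'_def B_def using assms by (simp_all add: scaled_hyp_pos)
  have lip: "\<bar>A - A'\<bar> \<le> \<bar>a - a'\<bar>" "\<bar>a'\<bar> \<le> A'" "\<bar>b\<bar> \<le> B"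
    unfolding A_def A'_def B_def by (rule scaled_hyp_lipschitz abs_le_scaled_hyp)+
  have eq: "spec_mean_scaled s a b - spec_mean_scaled s a' b =
      B * ((a - a') * A' + a' * (A' - A) + (a - a') * B + b * (A - A')) / ((A + B) * (A' + B))"
    using assms pos
    by (simp add: spec_mean_scaled_eq_weighted flip: A_def A'_def B_def)
      (simp add: diff_frac_eq algebra_simps)
  have "\<bar>a' * (A' - A)\<bar> \<le> A' * \<bar>a - a'\<bar>" "\<bar>b * (A - A')\<bar> \<le> B * \<bar>a - a'\<bar>"
    unfolding abs_mult using lip pos by (auto intro!: mult_mono)
  moreover have "\<bar>(a - a') * A'\<bar> = A' * \<bar>a - a'\<bar>" "\<bar>(a - a') * B\<bar> = B * \<bar>a - a'\<bar>"
    using pos by (simp_all add: abs_mult)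
  ultimately have "\<bar>(a - a') * A' + a' * (A' - A) + (a - a') * B + b * (A - A')\<bar>
      \<le> 2 * (A' * \<bar>a - a'\<bar>) + 2 * (B * \<bar>a - a'\<bar>)"
    by linarith
  also have "\<dots> = 2 * \<bar>a - a'\<bar> * (A' + B)"
    by (simp add: algebra_simps)
  finally have "B * \<bar>(a - a') * A' + a' * (A' - A) + (a - a') * B + b * (A - A')\<bar>
      \<le> (A + B) * (2 * \<bar>a - a'\<bar> * (A' + B))"
    using pos by (intro mult_mono) auto
  then show ?thesis
    unfolding eq using pos by (simp add: abs_mult pos_divide_le_eq mult_ac)
qed

lemma spec_mean_scaled_lipschitz:
  assumes "s > 0"
  shows "\<bar>spec_mean_scaled s a b - spec_mean_scaled s a' b'\<bar> \<le> 2 * (\<bar>a - a'\<bar> + \<bar>b - b'\<bar>)"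
  using spec_mean_scaled_lipschitz_left[OF assms, of a b a']
    spec_mean_scaled_lipschitz_left[OF assms, of b a' b']
  by (simp add: spec_mean_scaled_commute[of s a'])

section \<open>The factor in the correction to the trapezoidal rule\<close>

text \<open>The numerator is at most the sum of the hypotenuses and cancels one of the two powers
  below. The other power is at least \<open>c\<close>, since a lower bound for one hypotenuse passes
  to the sum.\<close>

lemma correction_factor_bound:
  assumes "c > 0" "c \<le> scaled_hyp s b"
  shows "\<bar>(a + b) / (scaled_hyp s a + scaled_hyp s b)\<^sup>2\<bar> \<le> 1 / c"
proof -
  define S where "S = scaled_hyp s a + scaled_hyp s b"
  have S: "c \<le> S" "\<bar>a + b\<bar> \<le> S"
    using assms abs_add_le_scaled_hyp[of a b s] abs_le_scaled_hyp[of a s] by (auto simp: S_def)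
  have "\<bar>a + b\<bar> * c \<le> S * S"
    using S assms by (intro mult_mono) auto
  then show ?thesis
    using S assms by (simp add: flip: S_def) (simp add: field_simps power2_eq_square)
qed

text \<open>The subtracted term is the value of the factor at \<open>a = b\<close>; moving one
  argument away costs first order in \<open>a - b\<close>. The third-order estimate uses this,
  because there the curvature condition concerns the left grid point only.\<close>

lemma correction_factor_left:
  assumes "c > 0" "c \<le> scaled_hyp s b"
  shows "\<bar>(a + b) / (scaled_hyp s a + scaled_hyp s b)\<^sup>2 - b / (2 * (scaled_hyp s b)\<^sup>2)\<bar>
    \<le> 5 / 2 * \<bar>a - b\<bar> / c\<^sup>2"
proof -
  define A B where "A = scaled_hyp s a" and "B = scaled_hyp s b"
  have A: "A \<ge> 0" and B: "B \<ge> c" "\<bar>b\<bar> \<le> B" and AB: "\<bar>B - A\<bar> \<le> \<bar>a - b\<bar>"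
    using assms abs_le_scaled_hyp[of a s] abs_le_scaled_hyp[of b s] scaled_hyp_lipschitz[of s a b]
    by (auto simp: A_def B_def)
  have pos: "B > 0" "A + B > 0"
    using A B assms by auto
  \<comment> \<open>The change of the numerator is separated from that of the denominator, where
    \<open>4 * B^2 - (A + B)^2 = (B - A) * (3 * B + A)\<close>.\<close>
  have "(a + b) / (A + B)\<^sup>2 - b / (2 * B\<^sup>2) =
      (a - b) / (A + B)\<^sup>2 + b * (B - A) * (3 * B + A) / (2 * B\<^sup>2 * (A + B)\<^sup>2)"
    using pos by (simp add: divide_simps) (simp add: algebra_simps power2_eq_square)
  moreover have "\<bar>(a - b) / (A + B)\<^sup>2\<bar> \<le> \<bar>a - b\<bar> / c\<^sup>2"
    unfolding abs_divide using A B assms by (intro frac_le) (auto intro!: power_mono)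
  moreover have "\<bar>b * (B - A) * (3 * B + A) / (2 * B\<^sup>2 * (A + B)\<^sup>2)\<bar> \<le> 3 / 2 * \<bar>a - b\<bar> / c\<^sup>2"
  proof -
    have "\<bar>b * (B - A) * (3 * B + A)\<bar> \<le> B * \<bar>a - b\<bar> * (3 * (A + B))"
      unfolding abs_mult using A B AB pos by (intro mult_mono) auto
    then have "\<bar>b * (B - A) * (3 * B + A) / (2 * B\<^sup>2 * (A + B)\<^sup>2)\<bar>
        \<le> B * \<bar>a - b\<bar> * (3 * (A + B)) / (2 * B\<^sup>2 * (A + B)\<^sup>2)"
      unfolding abs_divide using pos by (simp add: divide_right_mono abs_mult)
    also have "\<dots> = 3 * \<bar>a - b\<bar> / (2 * (B * (A + B)))"
      using pos by (simp add: power2_eq_square divide_simps)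
    also have "\<dots> \<le> 3 * \<bar>a - b\<bar> / (2 * (c * c))"
      using A B assms by (intro divide_left_mono mult_left_mono mult_mono) auto
    finally show ?thesis
      by (simp add: power2_eq_square)
  qed
  ultimately show ?thesis
    unfolding A_def[symmetric] B_def[symmetric] by linarith
qed

text \<open>A symmetric function of two arguments and the average of its diagonal values differ only
  to second order in the distance of the arguments.\<close>

lemma correction_factor_symmetric:
  assumes "c > 0" "c \<le> scaled_hyp s a" "c \<le> scaled_hyp s b"
  shows "\<bar>(a + b) / (scaled_hyp s a + scaled_hyp s b)\<^sup>2
      - (a / (scaled_hyp s a)\<^sup>2 + b / (scaled_hyp s b)\<^sup>2) / 4\<bar> \<le> (a - b)\<^sup>2 / c ^ 3"
proof -
  define A B where "A = scaled_hyp s a" and "B = scaled_hyp s b"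
  define S E where "S = A + B" and "E = A - B"
  have c: "c \<le> A" "c \<le> B"
    using assms by (auto simp: A_def B_def)
  have pos: "A > 0" "B > 0" "S > 0"
    using c assms by (auto simp: S_def)
  have ab: "\<bar>a + b\<bar> \<le> S"
    unfolding S_def A_def B_def by (rule abs_add_le_scaled_hyp)
  have E: "E\<^sup>2 \<le> (a - b)\<^sup>2"
    using scaled_hyp_lipschitz[of s a b] unfolding E_def A_def B_def by (simp add: abs_le_square_iff)
  have ES: "E\<^sup>2 \<le> S\<^sup>2"
    using pos unfolding E_def S_def by (intro power2_le_iff_abs_le[THEN iffD2]) auto
  have "A\<^sup>2 - B\<^sup>2 = a\<^sup>2 - b\<^sup>2"
    by (simp add: A_def B_def scaled_hyp_square)
  then have num: "a * B\<^sup>2 + b * A\<^sup>2 = (a + b) * (A\<^sup>2 + B\<^sup>2 - (a - b)\<^sup>2) / 2"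
    by algebra
  \<comment> \<open>This is the square of \<open>4 * A * B = S^2 - E^2\<close>, rearranged by
    \<open>2 * (A^2 + B^2) = S^2 + E^2\<close> so that its main term cancels against that of
    \<open>num\<close> and only terms with \<open>E^2\<close> or \<open>(a - b)^2\<close>
    survive.\<close>
  have "16 * (A\<^sup>2 * B\<^sup>2) = E\<^sup>2 * (E\<^sup>2 - 3 * S\<^sup>2) + 2 * (A\<^sup>2 + B\<^sup>2) * S\<^sup>2"
    unfolding S_def E_def by algebra
  then have prod: "A\<^sup>2 * B\<^sup>2 = E\<^sup>2 * (E\<^sup>2 - 3 * S\<^sup>2) / 16 + (A\<^sup>2 + B\<^sup>2) * S\<^sup>2 / 8"
    by linarith
  have "(a + b) / S\<^sup>2 - (a / A\<^sup>2 + b / B\<^sup>2) / 4 =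
      (4 * (a + b) * (A\<^sup>2 * B\<^sup>2) - (a * B\<^sup>2 + b * A\<^sup>2) * S\<^sup>2) / (4 * (A\<^sup>2 * B\<^sup>2) * S\<^sup>2)"
    using pos by (simp add: divide_simps)
  also have "4 * (a + b) * (A\<^sup>2 * B\<^sup>2) - (a * B\<^sup>2 + b * A\<^sup>2) * S\<^sup>2 =
      (a + b) * (E\<^sup>2 * (E\<^sup>2 - 3 * S\<^sup>2) / 4 + (a - b)\<^sup>2 * S\<^sup>2 / 2)"
    unfolding num prod by (simp add: field_simps)
  finally have eq: "\<bar>(a + b) / S\<^sup>2 - (a / A\<^sup>2 + b / B\<^sup>2) / 4\<bar> =
      \<bar>a + b\<bar> * \<bar>E\<^sup>2 * (E\<^sup>2 - 3 * S\<^sup>2) / 4 + (a - b)\<^sup>2 * S\<^sup>2 / 2\<bar> / (4 * (A\<^sup>2 * B\<^sup>2) * S\<^sup>2)"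
    using pos by (simp add: abs_mult)
  have "\<bar>E\<^sup>2 - 3 * S\<^sup>2\<bar> \<le> 3 * S\<^sup>2"
    using ES zero_le_power2[of E] by linarith
  then have "\<bar>E\<^sup>2 * (E\<^sup>2 - 3 * S\<^sup>2)\<bar> \<le> (a - b)\<^sup>2 * (3 * S\<^sup>2)"
    unfolding abs_mult using E by (intro mult_mono) auto
  moreover have "\<bar>(a - b)\<^sup>2 * S\<^sup>2\<bar> = (a - b)\<^sup>2 * S\<^sup>2"
    by simp
  ultimately have "\<bar>E\<^sup>2 * (E\<^sup>2 - 3 * S\<^sup>2) / 4 + (a - b)\<^sup>2 * S\<^sup>2 / 2\<bar> \<le> 2 * ((a - b)\<^sup>2 * S\<^sup>2)"
    by linarith
  then have "\<bar>a + b\<bar> * \<bar>E\<^sup>2 * (E\<^sup>2 - 3 * S\<^sup>2) / 4 + (a - b)\<^sup>2 * S\<^sup>2 / 2\<bar>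
      \<le> S * (2 * ((a - b)\<^sup>2 * S\<^sup>2))"
    using ab pos by (intro mult_mono) auto
  then have "\<bar>(a + b) / S\<^sup>2 - (a / A\<^sup>2 + b / B\<^sup>2) / 4\<bar>
      \<le> S * (2 * ((a - b)\<^sup>2 * S\<^sup>2)) / (4 * (A\<^sup>2 * B\<^sup>2) * S\<^sup>2)"
    unfolding eq by (rule divide_right_mono) simp
  also have "\<dots> = (a - b)\<^sup>2 / 2 * (1 / (A * (B * B)) + 1 / (A * A * B))"
    using pos by (simp add: S_def divide_simps) (simp add: algebra_simps power2_eq_square)
  also have "\<dots> \<le> (a - b)\<^sup>2 / 2 * (1 / (c * (c * c)) + 1 / (c * c * c))"
    using c pos assms by (intro mult_left_mono add_mono divide_left_mono mult_mono) auto
  finally show ?thesis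
    by (simp add: A_def B_def S_def power3_eq_cube mult.assoc)
qed

text \<open>The numerator of the difference is \<open>(a - b) * (s^2 - a * b)\<close>, and its
  second factor is at most \<open>A * B\<close> by the Cauchy-Schwarz inequality for
  \<open>(s, a)\<close> and \<open>(s, - b)\<close>. The fourth-order estimate compares the two
  endpoints with it.\<close>

lemma scaled_ratio_lipschitz:
  assumes "c > 0" "c \<le> scaled_hyp s a" "c \<le> scaled_hyp s b"
  shows "\<bar>a / (scaled_hyp s a)\<^sup>2 - b / (scaled_hyp s b)\<^sup>2\<bar> \<le> \<bar>a - b\<bar> / c\<^sup>2"
proof -
  define A B where "A = scaled_hyp s a" and "B = scaled_hyp s b"
  have c: "c \<le> A" "c \<le> B" and pos: "A > 0" "B > 0"
    using assms by (auto simp: A_def B_def)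
  have "\<bar>s\<^sup>2 - a * b\<bar> \<le> \<bar>A * B\<bar>"
  proof (rule power2_le_iff_abs_le[THEN iffD1, OF abs_ge_zero, THEN order_trans])
    have "(A * B)\<^sup>2 - (s\<^sup>2 - a * b)\<^sup>2 = (s * (a + b))\<^sup>2"
      by (simp add: power_mult_distrib A_def B_def scaled_hyp_square) algebra
    then show "(s\<^sup>2 - a * b)\<^sup>2 \<le> \<bar>A * B\<bar>\<^sup>2"
      using zero_le_power2[of "s * (a + b)"] by (simp only: power2_abs)
  qed simp
  then have cs: "\<bar>s\<^sup>2 - a * b\<bar> \<le> A * B"
    using pos by simp
  have "a * B\<^sup>2 - b * A\<^sup>2 = (a - b) * (s\<^sup>2 - a * b)"
    by (simp add: A_def B_def scaled_hyp_square) algebra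
  then have "a / A\<^sup>2 - b / B\<^sup>2 = (a - b) * (s\<^sup>2 - a * b) / (A\<^sup>2 * B\<^sup>2)"
    using pos by (simp add: diff_frac_eq)
  then have "\<bar>a / A\<^sup>2 - b / B\<^sup>2\<bar> \<le> \<bar>a - b\<bar> * (A * B) / (A\<^sup>2 * B\<^sup>2)"
    using cs by (simp add: abs_mult divide_right_mono mult_left_mono)
  also have "\<dots> = \<bar>a - b\<bar> / (A * B)"
    using pos by (simp add: power2_eq_square)
  also have "\<dots> \<le> \<bar>a - b\<bar> / (c * c)"
    using c pos assms by (intro divide_left_mono mult_mono) auto
  finally show ?thesis
    by (simp add: A_def B_def power2_eq_square)
qed

subsection \<open>Stability\<close>

lemma grid_Suc: "grid t0 h (Suc n) = grid t0 h n + h"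
  by (simp add: grid_def algebra_simps)

lemma le_num_steps_iff:
  assumes "h > 0" "t0 \<le> T"
  shows "n \<le> num_steps t0 T h \<longleftrightarrow> grid t0 h n \<le> T"
proof -
  have "n \<le> num_steps t0 T h \<longleftrightarrow> real n \<le> inverse h * (T - t0)"
    using assms by (simp add: num_steps_def nat_le_iff le_nat_iff le_floor_iff)
  also have "\<dots> \<longleftrightarrow> grid t0 h n \<le> T"
    using assms by (simp add: grid_def field_simps)
  finally show ?thesis .
qed

text \<open>Each of the \<open>n\<close> terms of the geometric sum is bounded by
  \<open>(1 + q) ^ n\<close>. Without a division by \<open>q\<close> the bound also covers
  \<open>q = 0\<close>, hence a vanishing Lipschitz constant.\<close>

lemma discrete_gronwall:
  fixes e :: "nat \<Rightarrow> real"
  assumes "e 0 \<le> 0" "q \<ge> 0" "c \<ge> 0"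
    and "\<And>n. n < N \<Longrightarrow> e (Suc n) \<le> (1 + q) * e n + c" and "n \<le> N"
  shows "e n \<le> c * real n * (1 + q) ^ n"
  using \<open>n \<le> N\<close>
proof (induction n)
  case 0
  then show ?case using assms by simp
next
  case (Suc n)
  have "e (Suc n) \<le> (1 + q) * e n + c"
    using Suc assms by simp
  also have "\<dots> \<le> (1 + q) * (c * real n * (1 + q) ^ n) + c * (1 + q) ^ Suc n"
    using Suc assms mult_left_mono[of 1 "(1 + q) ^ Suc n" c] one_le_power[of "1 + q" "Suc n"]
    by (intro add_mono mult_left_mono) auto
  also have "\<dots> = c * real (Suc n) * (1 + q) ^ Suc n"
    by (simp add: algebra_simps)
  finally show ?case .
qed

text \<open>Banach's fixed point theorem on a closed ball. Only existence is kept; uniqueness of an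
  implicit step comes from its own contraction estimate.\<close>

lemma lipschitz_self_map_has_fixpoint:
  fixes f :: "real \<Rightarrow> real"
  assumes "0 \<le> k" "k < 1" "r \<ge> 0"
    and "\<And>x y. \<bar>x - a\<bar> \<le> r \<Longrightarrow> \<bar>y - a\<bar> \<le> r \<Longrightarrow> \<bar>f x - f y\<bar> \<le> k * \<bar>x - y\<bar>"
    and "\<And>x. \<bar>x - a\<bar> \<le> r \<Longrightarrow> \<bar>f x - a\<bar> \<le> r"
  shows "\<exists>x. \<bar>x - a\<bar> \<le> r \<and> f x = x"
proof -
  have mem: "x \<in> cball a r \<longleftrightarrow> \<bar>x - a\<bar> \<le> r" for x
    by (simp add: dist_real_def abs_minus_commute)
  have "\<exists>!x\<in>cball a r. f x = x"
  proof (rule Banach_fix)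
    show "complete (cball a r)"
      by (simp add: complete_eq_closed)
    show "f ` cball a r \<subseteq> cball a r"
      unfolding image_subset_iff Ball_def mem using assms(5) by blast
    show "dist (f x) (f y) \<le> k * dist x y" if "x \<in> cball a r" "y \<in> cball a r" for x y
      using that assms(4) unfolding mem dist_real_def by blast
  qed (use assms in auto)
  then show ?thesis
    unfolding mem by blast
qed

text \<open>The mean is Lipschitz with constant 2 uniformly in the scale, so the implicit step is a
  contraction and its stability constant does not depend on the scales.\<close>

lemma SE_convergence_order_if_consistent:
  assumes T: "t0 < T" and p: "p > 0" and \<rho>: "\<rho> > 0" and L: "L \<ge> 0" and H: "H > 0"
    and lip: "\<And>t x y. (t, x) \<in> tube t0 T u \<rho> \<Longrightarrow> (t, y) \<in> tube t0 T u \<rho> \<Longrightarrow>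
           \<bar>F (t, x) - F (t, y)\<bar> \<le> L * \<bar>x - y\<bar>"
    and \<sigma>: "\<And>h n. h \<in> {0<..H} \<Longrightarrow> n < num_steps t0 T h \<Longrightarrow> \<sigma> h n > 0"
    and h1: "h1 > 0"
    and K: "K \<ge> 0"
    and consistent: "\<And>h n. h \<in> {0<..H} \<Longrightarrow> h \<le> h1 \<Longrightarrow> n < num_steps t0 T h \<Longrightarrow>
           \<bar>u (grid t0 h (Suc n)) - u (grid t0 h n)
             - h * spec_mean_scaled (\<sigma> h n) (F (grid t0 h (Suc n), u (grid t0 h (Suc n))))
                 (F (grid t0 h n, u (grid t0 h n)))\<bar> \<le> K * h ^ Suc p"
  shows "SE_convergence_order F t0 T u \<rho> H \<sigma> p"
proof -
  \<comment> \<open>The error constant is what the Gronwall bound yields from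
    \<open>n * h \<le> T - t0\<close>; the summand 1 keeps it positive when
    \<open>K = 0\<close>.\<close>
  define E where "E = 2 * K * (T - t0) * exp (8 * L * (T - t0)) + 1"
  have E: "E > 0"
    using T K by (simp add: E_def add_nonneg_pos)
  \<comment> \<open>The entries give, in turn: \<open>h ^ p \<le> h\<close>, the two ranges of
    validity, a contraction factor \<open>2 * h * L\<close> of at most 1/4, and global and local
    errors of at most \<open>\<rho> / 5\<close>.\<close>
  define h0 where "h0 = Min {1, H, h1, 1 / (8 * L + 1), \<rho> / (5 * (E + K))}"
  have EK: "E + K > 0"
    using E K by simp
  have h0_pos: "h0 > 0"
    unfolding h0_def using H h1 L \<rho> EK by (simp add: divide_pos_pos add_nonneg_pos)
  have "\<exists>w. (SE_sequence F t0 T u h (\<sigma> h) w \<and>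
             (\<forall>n\<le>num_steps t0 T h. (grid t0 h n, w n) \<in> tube t0 T u \<rho>)) \<and>
          (\<forall>v. SE_sequence F t0 T u h (\<sigma> h) v \<and>
             (\<forall>n\<le>num_steps t0 T h. (grid t0 h n, v n) \<in> tube t0 T u \<rho>)
             \<longrightarrow> (\<forall>n\<le>num_steps t0 T h. v n = w n)) \<and>
          (MAX n\<in>{0..num_steps t0 T h}. \<bar>u (grid t0 h n) - w n\<bar>) \<le> E * h ^ p"
    if h: "h \<in> {0<..h0}" for h
  proof -
    define N where "N = num_steps t0 T h"
    define t where "t = grid t0 h"
    \<comment> \<open>The fixed points \<open>y\<close> of \<open>\<Phi> n x\<close> are exactly the
      results of an implicit step from \<open>x\<close>.\<close>
    define \<Phi> where "\<Phi> n x y = x + h * spec_mean_scaled (\<sigma> h n) (F (t (Suc n), y)) (F (t n, x))"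
      for n x y
    have h_pos: "h > 0" and "h \<le> h0"
      using h by auto
    then have h_le: "h \<le> 1" "h \<le> H" "h \<le> h1" "h \<le> 1 / (8 * L + 1)" "h \<le> \<rho> / (5 * (E + K))"
      by (auto simp: h0_def)
    have hL: "8 * (h * L) \<le> 1"
      using h_le(4) h_pos L by (simp add: field_simps)
    have hL0: "h * L \<ge> 0"
      using h_pos L by simp
    have hEK: "h * E + h * K \<le> \<rho> / 5"
      using h_le(5) EK by (simp add: field_simps)
    have hp: "h ^ p \<le> h"
      using power_decreasing[of 1 p h] h_pos h_le(1) p by simp
    have EK_p: "E * h ^ p \<le> \<rho> / 5" "K * h ^ Suc p \<le> \<rho> / 5"
    proof -
      have "E * h ^ p \<le> h * E"
        using hp E by (simp add: mult.commute)
      moreover have "h ^ Suc p \<le> h"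
        using hp h_pos h_le(1) mult_mono[of h 1 "h ^ p" h] by simp
      then have "K * h ^ Suc p \<le> h * K"
        using K by (simp add: mult.commute mult_left_mono)
      moreover have "h * E \<ge> 0" "h * K \<ge> 0"
        using h_pos E K by auto
      ultimately show "E * h ^ p \<le> \<rho> / 5" "K * h ^ Suc p \<le> \<rho> / 5"
        using hEK by linarith+
    qed
    have t_in: "t n \<in> {t0..T}" if "n \<le> N" for n
      using that le_num_steps_iff[OF h_pos, of t0 T n] T h_pos
      by (simp add: N_def t_def) (simp add: grid_def)
    have tube: "(t n, x) \<in> tube t0 T u \<rho> \<longleftrightarrow> \<bar>x - u (t n)\<bar> \<le> \<rho>" if "n \<le> N" for n x
      using t_in[OF that] by (simp add: tube_def)
    have lip': "\<bar>F (t n, x) - F (t n, y)\<bar> \<le> L * \<bar>x - y\<bar>"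
      if "n \<le> N" "\<bar>x - u (t n)\<bar> \<le> \<rho>" "\<bar>y - u (t n)\<bar> \<le> \<rho>" for n x y
      using that by (intro lip) (simp_all add: tube)
    have \<sigma>_pos: "\<sigma> h n > 0" if "n < N" for n
      using that h_pos h_le by (intro \<sigma>) (auto simp: N_def)
    have step_diff: "\<bar>\<Phi> n x y - \<Phi> n x' y'\<bar> \<le> \<bar>x - x'\<bar> + 2 * (h * L) * (\<bar>y - y'\<bar> + \<bar>x - x'\<bar>)"
      if "n < N" "\<bar>x - u (t n)\<bar> \<le> \<rho>" "\<bar>x' - u (t n)\<bar> \<le> \<rho>"
        "\<bar>y - u (t (Suc n))\<bar> \<le> \<rho>" "\<bar>y' - u (t (Suc n))\<bar> \<le> \<rho>" for n x x' y y'
    proof -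
      define D where "D = spec_mean_scaled (\<sigma> h n) (F (t (Suc n), y)) (F (t n, x))
          - spec_mean_scaled (\<sigma> h n) (F (t (Suc n), y')) (F (t n, x'))"
      have "\<bar>D\<bar> \<le> 2 * (\<bar>F (t (Suc n), y) - F (t (Suc n), y')\<bar> + \<bar>F (t n, x) - F (t n, x')\<bar>)"
        unfolding D_def by (intro spec_mean_scaled_lipschitz \<sigma>_pos that)
      also have "\<dots> \<le> 2 * (L * \<bar>y - y'\<bar> + L * \<bar>x - x'\<bar>)"
        using that by (intro mult_left_mono add_mono lip') auto
      finally have "h * \<bar>D\<bar> \<le> h * (2 * (L * \<bar>y - y'\<bar> + L * \<bar>x - x'\<bar>))"
        using h_pos by (intro mult_left_mono) auto
      also have "\<dots> = 2 * (h * L) * (\<bar>y - y'\<bar> + \<bar>x - x'\<bar>)"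
        by (simp add: algebra_simps)
      finally have "\<bar>h * D\<bar> \<le> 2 * (h * L) * (\<bar>y - y'\<bar> + \<bar>x - x'\<bar>)"
        using h_pos by (simp add: abs_mult)
      moreover have "\<Phi> n x y - \<Phi> n x' y' = (x - x') + h * D"
        by (simp add: \<Phi>_def D_def algebra_simps)
      ultimately show ?thesis
        using abs_triangle_ineq[of "x - x'" "h * D"] by linarith
    qed
    have consistent': "\<bar>\<Phi> n (u (t n)) (u (t (Suc n))) - u (t (Suc n))\<bar> \<le> K * h ^ Suc p" if "n < N" for n
      using consistent[of h n] that h_pos h_le
      by (simp add: \<Phi>_def t_def N_def abs_minus_commute diff_diff_eq)
    have step_unique: "y = y'"
      if "n < N" "\<bar>x - u (t n)\<bar> \<le> \<rho>" "\<bar>y - u (t (Suc n))\<bar> \<le> \<rho>" "\<bar>y' - u (t (Suc n))\<bar> \<le> \<rho>"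
        "\<Phi> n x y = y" "\<Phi> n x y' = y'" for n x y y'
    proof -
      have "\<bar>y - y'\<bar> \<le> 2 * (h * L) * \<bar>y - y'\<bar>"
        using step_diff[of n x x y y'] that by simp
      also have "\<dots> \<le> (1 / 4) * \<bar>y - y'\<bar>"
        using hL by (intro mult_right_mono) auto
      finally show ?thesis by simp
    qed
    have step_exists: "\<exists>y. \<bar>y - u (t (Suc n))\<bar> \<le> \<rho> \<and> \<Phi> n x y = y"
      if n: "n < N" and x: "\<bar>x - u (t n)\<bar> \<le> E * h ^ p" for n x
    proof (rule lipschitz_self_map_has_fixpoint[of "2 * (h * L)"])
      have x': "\<bar>x - u (t n)\<bar> \<le> \<rho> / 5" "\<bar>x - u (t n)\<bar> \<le> \<rho>"
        using x EK_p \<rho> by auto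
      show "0 \<le> 2 * (h * L)" "2 * (h * L) < 1" "0 \<le> \<rho>"
        using hL hL0 \<rho> by auto
      show "\<bar>\<Phi> n x y - \<Phi> n x y'\<bar> \<le> 2 * (h * L) * \<bar>y - y'\<bar>"
        if "\<bar>y - u (t (Suc n))\<bar> \<le> \<rho>" "\<bar>y' - u (t (Suc n))\<bar> \<le> \<rho>" for y y'
        using step_diff[of n x x y y'] that n x' by simp
      show "\<bar>\<Phi> n x y - u (t (Suc n))\<bar> \<le> \<rho>" if y: "\<bar>y - u (t (Suc n))\<bar> \<le> \<rho>" for y
      proof -
        have "\<bar>\<Phi> n x y - \<Phi> n (u (t n)) (u (t (Suc n)))\<bar>
            \<le> \<bar>x - u (t n)\<bar> + 2 * (h * L) * (\<bar>y - u (t (Suc n))\<bar> + \<bar>x - u (t n)\<bar>)"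
          using n x' y \<rho> by (intro step_diff) auto
        \<comment> \<open>The error of \<open>x\<close> costs \<open>\<rho> / 5\<close> and the
          contraction term \<open>3 * \<rho> / 10\<close>; with \<open>\<rho> / 5\<close> for the
          local error the image stays within \<open>7 * \<rho> / 10\<close> of the solution.\<close>
        also have "\<dots> \<le> \<rho> / 5 + 1 / 4 * (\<rho> + \<rho> / 5)"
          using hL x' y by (intro add_mono mult_mono) auto
        finally have "\<bar>\<Phi> n x y - \<Phi> n (u (t n)) (u (t (Suc n)))\<bar> \<le> \<rho> / 2"
          by simp
        then show ?thesis
          using consistent'[OF n] EK_p \<rho> by linarith
      qed
    qed
    \<comment> \<open>The choice is meaningful only while the error bound holds, for only then is
      the next step known to be solvable. Existence and error are therefore established
      together.\<close>
    define w where "w = rec_nat (u t0)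
      (\<lambda>n x. SOME y. \<bar>y - u (t (Suc n))\<bar> \<le> \<rho> \<and> \<Phi> n x y = y)"
    have w0: "w 0 = u t0"
      by (simp add: w_def)
    have w_Suc: "\<bar>w (Suc n) - u (t (Suc n))\<bar> \<le> \<rho> \<and> \<Phi> n (w n) (w (Suc n)) = w (Suc n)"
      if "n < N" "\<bar>w n - u (t n)\<bar> \<le> E * h ^ p" for n
      using someI_ex[OF step_exists[OF that]] by (simp add: w_def)
    have error_step: "\<bar>w (Suc n) - u (t (Suc n))\<bar>
        \<le> (1 + 8 * (h * L)) * \<bar>w n - u (t n)\<bar> + 2 * (K * h ^ Suc p)"
      if n: "n < N" and wn: "\<bar>w n - u (t n)\<bar> \<le> E * h ^ p" for n
    proof -
      define e e' q where "e = \<bar>w n - u (t n)\<bar>" and "e' = \<bar>w (Suc n) - u (t (Suc n))\<bar>"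
        and "q = 2 * (h * L)"
      have "\<bar>\<Phi> n (w n) (w (Suc n)) - \<Phi> n (u (t n)) (u (t (Suc n)))\<bar> \<le> e + q * (e' + e)"
        unfolding e_def e'_def q_def using n wn w_Suc[OF n wn] EK_p \<rho> by (intro step_diff) auto
      then have "e' \<le> e + q * (e' + e) + K * h ^ Suc p"
        using consistent'[OF n] w_Suc[OF n wn] unfolding e'_def by linarith
      then have 1: "(1 - q) * e' \<le> (1 + q) * e + K * h ^ Suc p"
        by (simp add: algebra_simps)
      have q: "0 \<le> q" "q \<le> 1 / 4"
        using hL hL0 by (auto simp: q_def)
      \<comment> \<open>The implicit error \<open>e'\<close> has been moved to the left. For
        \<open>q \<le> 1 / 4\<close> division by \<open>1 - q\<close> costs little:
        \<open>(1 + q) / (1 - q) \<le> 1 + 4 * q\<close> and \<open>1 / (1 - q) \<le> 2\<close>,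
        where \<open>4 * q = 8 * (h * L)\<close>.\<close>
      have "(1 + q) * e \<le> (1 - q) * (1 + 4 * q) * e"
      proof (rule mult_right_mono)
        have "q * (2 - 4 * q) \<ge> 0"
          using q by auto
        then show "1 + q \<le> (1 - q) * (1 + 4 * q)"
          by (simp add: algebra_simps)
      qed (simp add: e_def)
      moreover have "1 * (K * h ^ Suc p) \<le> ((1 - q) * 2) * (K * h ^ Suc p)"
        using q K h_pos by (intro mult_right_mono) auto
      ultimately have "(1 - q) * e' \<le> (1 - q) * ((1 + 4 * q) * e + 2 * (K * h ^ Suc p))"
        using 1 by (simp only: distrib_left[of "1 - q" _ "2 * _"] mult.assoc mult_1)
      then have "e' \<le> (1 + 4 * q) * e + 2 * (K * h ^ Suc p)"
        using q by (simp only: mult_le_cancel_left_pos)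
      then show ?thesis
        by (simp add: e_def e'_def q_def)
    qed
    have bound: "2 * (K * h ^ Suc p) * real n * (1 + 8 * (h * L)) ^ n \<le> E * h ^ p" if "n \<le> N" for n
    proof -
      have nh: "real n * h \<le> T - t0"
        using t_in[OF that] by (simp add: t_def grid_def)
      have "(1 + 8 * (h * L)) ^ n \<le> exp (8 * (h * L)) ^ n"
        using hL0 by (intro power_mono) auto
      also have "\<dots> = exp (8 * L * (real n * h))"
        by (simp add: exp_of_nat_mult[symmetric] mult_ac)
      also have "\<dots> \<le> exp (8 * L * (T - t0))"
        using nh L by (simp add: mult_left_mono)
      finally have pow: "(1 + 8 * (h * L)) ^ n \<le> exp (8 * L * (T - t0))" .
      have "2 * (K * h ^ Suc p) * real n * (1 + 8 * (h * L)) ^ n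
          = (2 * K * h ^ p) * ((real n * h) * (1 + 8 * (h * L)) ^ n)"
        by simp
      also have "\<dots> \<le> (2 * K * h ^ p) * ((T - t0) * exp (8 * L * (T - t0)))"
        using nh pow T K h_pos hL0 by (intro mult_left_mono mult_mono) auto
      also have "\<dots> \<le> E * h ^ p"
        using h_pos by (simp add: E_def algebra_simps)
      finally show ?thesis .
    qed
    \<comment> \<open>Strong induction is required: the recursion at \<open>m < n\<close>
      presupposes the error bound at \<open>m\<close>. Gronwall's inequality is thus applied only up
      to the current \<open>n\<close>.\<close>
    have error: "\<bar>w n - u (t n)\<bar> \<le> E * h ^ p" if "n \<le> N" for n
      using that
    proof (induction n rule: less_induct)
      case (less n)
      have "\<bar>w n - u (t n)\<bar> \<le> 2 * (K * h ^ Suc p) * real n * (1 + 8 * (h * L)) ^ n"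
      proof (rule discrete_gronwall[where N = n])
        show "\<bar>w (Suc m) - u (t (Suc m))\<bar>
            \<le> (1 + 8 * (h * L)) * \<bar>w m - u (t m)\<bar> + 2 * (K * h ^ Suc p)" if "m < n" for m
          using that less by (intro error_step) auto
      qed (use hL0 K h_pos in \<open>auto simp: w0 t_def grid_def\<close>)
      then show ?case
        using bound[OF less.prems] by linarith
    qed
    have in_tube: "\<bar>w n - u (t n)\<bar> \<le> \<rho>" if "n \<le> N" for n
      using error[OF that] EK_p \<rho> by linarith
    have admissible_iff: "SE_sequence F t0 T u h (\<sigma> h) v \<and> (\<forall>n\<le>N. (t n, v n) \<in> tube t0 T u \<rho>) \<longleftrightarrow>
        v 0 = u t0 \<and> (\<forall>n<N. \<Phi> n (v n) (v (Suc n)) = v (Suc n)) \<and> (\<forall>n\<le>N. \<bar>v n - u (t n)\<bar> \<le> \<rho>)" for v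
      by (auto simp: SE_sequence_def \<Phi>_def tube simp flip: N_def t_def)
    have "v n = w n"
      if v: "v 0 = u t0" "\<forall>n<N. \<Phi> n (v n) (v (Suc n)) = v (Suc n)" "\<forall>n\<le>N. \<bar>v n - u (t n)\<bar> \<le> \<rho>"
        and "n \<le> N" for v n
      using \<open>n \<le> N\<close>
    proof (induction n)
      case (Suc n)
      then have n: "n < N" "v n = w n"
        by auto
      show ?case
      proof (rule step_unique[OF n(1) in_tube])
        show "\<bar>v (Suc n) - u (t (Suc n))\<bar> \<le> \<rho>" "\<Phi> n (w n) (v (Suc n)) = v (Suc n)"
          using v n Suc.prems by (metis)+
        show "\<bar>w (Suc n) - u (t (Suc n))\<bar> \<le> \<rho>" "\<Phi> n (w n) (w (Suc n)) = w (Suc n)"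
          using w_Suc[OF n(1) error] n(1) by auto
      qed (use n in simp)
    qed (simp add: v w0)
    moreover have "w 0 = u t0 \<and> (\<forall>n<N. \<Phi> n (w n) (w (Suc n)) = w (Suc n)) \<and>
        (\<forall>n\<le>N. \<bar>w n - u (t n)\<bar> \<le> \<rho>)"
      using w0 w_Suc error in_tube by (metis less_imp_le_nat)
    moreover have "(MAX n\<in>{0..N}. \<bar>u (t n) - w n\<bar>) \<le> E * h ^ p"
      using error by (subst Max_le_iff) (auto simp: abs_minus_commute)
    ultimately show ?thesis
      unfolding N_def[symmetric] t_def[symmetric] admissible_iff by blast
  qed
  moreover have "h0 \<in> {0<..H}"
    using h0_pos by (auto simp: h0_def)
  ultimately show ?thesis
    unfolding SE_convergence_order_def Let_def using E by blast
qed

subsection \<open>Local truncation errors\<close>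

lemma deriv_on_eqI:
  fixes f g :: "real \<Rightarrow> 'a::euclidean_space"
  assumes "t0 < T" "t \<in> {t0..T}" "\<And>s. s \<in> {t0..T} \<Longrightarrow> f s = g s"
    and "(g has_vector_derivative d) (at t within {t0..T})"
  shows "deriv_on t0 T f t = d"
proof -
  have "(f has_vector_derivative d) (at t within {t0..T})"
    using assms by (intro has_vector_derivative_transform[OF assms(2) _ assms(4)]) auto
  then show ?thesis
    unfolding deriv_on_def using assms by (intro vector_derivative_within_closed_interval)
qed

text \<open>Replaces the recursive notion of smoothness by an explicit sequence of successive
  derivatives within the interval, which is the form Taylor's theorem takes.\<close>

lemma Ck_on_Icc_imp_derivs:
  assumes "Ck_on k f {a..b::real}"
  shows "\<exists>D. D 0 = f \<and>
    (\<forall>i<k. \<forall>t\<in>{a..b}. (D i has_real_derivative D (Suc i) t) (at t within {a..b})) \<and>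
    continuous_on {a..b} (D k)"
  using assms
proof (induction k arbitrary: f)
  case 0
  then show ?case by (auto intro: exI[of _ "\<lambda>_. f"])
next
  case (Suc k)
  \<comment> \<open>The only basis vector of the reals is 1, so this partial derivative is the
    ordinary derivative within the interval.\<close>
  define g where "g = (\<lambda>x. frechet_derivative f (at x within {a..b}) 1)"
  have "Ck_on k g {a..b}" and diff: "f differentiable_on {a..b}"
    using Suc.prems by (simp_all add: g_def)
  from Suc.IH[OF this(1)] obtain D where D: "D 0 = g"
    "\<forall>i<k. \<forall>t\<in>{a..b}. (D i has_real_derivative D (Suc i) t) (at t within {a..b})"
    "continuous_on {a..b} (D k)"
    by blast
  have deriv: "(f has_real_derivative g t) (at t within {a..b})" if "t \<in> {a..b}" for t
  proof -
    have "(f has_derivative frechet_derivative f (at t within {a..b})) (at t within {a..b})"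
      using diff that by (simp add: differentiable_on_def frechet_derivative_works)
    then show ?thesis
    proof (rule has_derivative_imp_has_field_derivative)
      fix x
      have "linear (frechet_derivative f (at t within {a..b}))"
        using diff that by (simp add: differentiable_on_def linear_frechet_derivative)
      then show "x * g t = frechet_derivative f (at t within {a..b}) x"
        using linear_scale[of "frechet_derivative f (at t within {a..b})" x 1] by (simp add: g_def)
    qed
  qed
  show ?case
  proof (intro exI[of _ "case_nat f D"] conjI allI impI ballI)
    fix i t assume "i < Suc k" "t \<in> {a..b}"
    then show "(case_nat f D i has_real_derivative case_nat f D (Suc i) t) (at t within {a..b})"
      using deriv D by (cases i) auto
  qed (use D in auto)
qed

text \<open>The common shape of the second- and third-order errors: \<open>x\<close> and
  \<open>y\<close> are Taylor remainders, \<open>w\<close> comes from the correction term.\<close>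

lemma abs_error_combination:
  fixes z x y w A B :: real
  assumes "z = x - y / 2 + w / 2" "\<bar>x\<bar> \<le> A" "\<bar>y\<bar> \<le> A" "\<bar>w\<bar> \<le> B"
  shows "\<bar>z\<bar> \<le> 3 / 2 * A + B / 2"
  using assms by linarith

text \<open>\<open>D i\<close> plays the role of the \<open>i\<close>-th derivative of
  \<open>D 0\<close>. A single bound \<open>M\<close> for all orders keeps the error constants
  simple, and its positivity allows step thresholds with \<open>M\<close> in the
  denominator.\<close>

locale bounded_derivs =
  fixes a b :: real and k :: nat and D :: "nat \<Rightarrow> real \<Rightarrow> real" and M :: real
  assumes less: "a < b"
    and deriv: "\<And>i t. i < k \<Longrightarrow> t \<in> {a..b} \<Longrightarrow>
      (D i has_real_derivative D (Suc i) t) (at t within {a..b})"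
    and bound: "\<And>i t. i \<le> k \<Longrightarrow> t \<in> {a..b} \<Longrightarrow> \<bar>D i t\<bar> \<le> M"
    and M_pos: "M > 0"

lemma Ck_on_Icc_imp_bounded_derivs:
  assumes "a < b" "Ck_on k f {a..b}"
  obtains D M where "bounded_derivs a b k D M" "D 0 = f"
proof -
  obtain D where D: "D 0 = f"
    "\<forall>i<k. \<forall>t\<in>{a..b}. (D i has_real_derivative D (Suc i) t) (at t within {a..b})"
    "continuous_on {a..b} (D k)"
    using Ck_on_Icc_imp_derivs[OF assms(2)] by blast
  have "\<exists>B. \<forall>t\<in>{a..b}. \<bar>D i t\<bar> \<le> B" if "i \<le> k" for i
  proof -
    have "continuous_on {a..b} (D i)"
    proof (cases "i = k")
      case False
      then show ?thesis
        using D(2) that by (intro DERIV_continuous_on[where D = "D (Suc i)"]) auto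
    qed (use D in simp)
    then have "bounded (D i ` {a..b})"
      by (intro compact_imp_bounded compact_continuous_image) auto
    then show ?thesis
      by (auto simp: bounded_iff)
  qed
  then obtain B where B: "\<forall>i\<le>k. \<forall>t\<in>{a..b}. \<bar>D i t\<bar> \<le> B i"
    by metis
  \<comment> \<open>The inserted 1 makes the bound positive even if all derivatives vanish.\<close>
  define M where "M = Max (insert 1 (B ` {..k}))"
  have "bounded_derivs a b k D M"
  proof
    fix i t assume it: "i \<le> k" "t \<in> {a..b}"
    then have "\<bar>D i t\<bar> \<le> B i"
      using B by blast
    also have "\<dots> \<le> M"
      unfolding M_def using it by (intro Max_ge) auto
    finally show "\<bar>D i t\<bar> \<le> M" .
  next
    have "1 \<le> M"
      unfolding M_def by (intro Max_ge) auto
    then show "M > 0" by simp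
  qed (use assms D in auto)
  then show ?thesis
    using D that by blast
qed

context bounded_derivs
begin

section \<open>Taylor expansion of the local error\<close>

text \<open>The factorial in the remainder is dropped; only the power of the distance matters for
  the order.\<close>

lemma taylor:
  assumes "m + n < k" "s \<in> {a..b}" "t \<in> {a..b}"
  shows "\<bar>D m s - (\<Sum>i\<le>n. D (m + i) t * (s - t) ^ i / fact i)\<bar> \<le> M * \<bar>s - t\<bar> ^ Suc n"
proof -
  have "norm (D (m + 0) s - (\<Sum>i\<le>n. D (m + i) t * (s - t) ^ i / fact i))
      \<le> M * norm (s - t) ^ Suc n / fact n"
    using assms by (intro field_Taylor[of "{a..b}" n "\<lambda>i. D (m + i)"]) (auto simp: deriv bound)
  also have "\<dots> \<le> M * norm (s - t) ^ Suc n / 1"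
    using M_pos by (intro divide_left_mono) (auto simp: fact_ge_1)
  finally show ?thesis by simp
qed

lemma increment_bound:
  assumes "m < k" "s \<in> {a..b}" "t \<in> {a..b}"
  shows "\<bar>D m s - D m t\<bar> \<le> M * \<bar>s - t\<bar>"
  using taylor[of m 0 s t] assms by simp

text \<open>The Taylor terms of the trapezoidal rule cancel up to \<open>h^2\<close>. The correction
  is \<open>h * d^2 * q / 2\<close> with \<open>d\<close> of order \<open>h\<close> and
  \<open>q\<close> bounded by \<open>1 / c\<close>, hence of order \<open>h^3\<close> as
  well.\<close>

lemma truncation_order2:
  assumes k: "3 \<le> k" and ts: "t \<in> {a..b}" "s \<in> {a..b}" and h: "s = t + h" "h \<ge> 0"
    and \<sigma>: "\<sigma> > 0" and c: "c > 0" "c \<le> scaled_hyp \<sigma> (D 1 t)"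
  shows "\<bar>D 0 s - D 0 t - h * spec_mean_scaled \<sigma> (D 1 s) (D 1 t)\<bar>
    \<le> (3 / 2 * M + M\<^sup>2 / (2 * c)) * h ^ 3"
proof -
  define q where "q = (D 1 s + D 1 t) / (scaled_hyp \<sigma> (D 1 s) + scaled_hyp \<sigma> (D 1 t))\<^sup>2"
  define d where "d = D 1 s - D 1 t"
  define R0 where "R0 = D 0 s - (D 0 t + h * D 1 t + h\<^sup>2 / 2 * D 2 t)"
  define R1 where "R1 = D 1 s - (D 1 t + h * D 2 t)"
  have R: "\<bar>R0\<bar> \<le> M * h ^ 3" "\<bar>R1\<bar> \<le> M * h\<^sup>2"
    using taylor[of 0 2 s t] taylor[of 1 1 s t] k ts h
    by (simp_all add: R0_def R1_def numeral_eq_Suc algebra_simps)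
  have hR1: "\<bar>h * R1\<bar> \<le> M * h ^ 3"
    using mult_left_mono[OF R(2) h(2)] h(2) by (simp add: abs_mult power2_eq_square power3_eq_cube mult_ac)
  have d: "\<bar>d\<bar> \<le> M * h"
    unfolding d_def using increment_bound[of 1 s t] k ts h by simp
  have "\<bar>d\<^sup>2 * q\<bar> \<le> (M * h)\<^sup>2 * (1 / c)"
    unfolding abs_mult using d correction_factor_bound[OF c, of "D 1 s"] M_pos h
    by (intro mult_mono) (auto simp: q_def simp flip: abs_le_square_iff)
  from mult_left_mono[OF this h(2)] h(2)
  have dq: "\<bar>h * (d\<^sup>2 * q)\<bar> \<le> M\<^sup>2 / c * h ^ 3"
    by (simp add: abs_mult power2_eq_square power3_eq_cube mult_ac)
  have "D 0 s - D 0 t - h * spec_mean_scaled \<sigma> (D 1 s) (D 1 t)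
      = R0 - h * R1 / 2 + h * (d\<^sup>2 * q) / 2"
    unfolding spec_mean_scaled_eq_trapezoid[OF \<sigma>] q_def[symmetric] d_def[symmetric]
    by (simp add: R0_def R1_def d_def field_simps power2_eq_square)
  then have "\<bar>D 0 s - D 0 t - h * spec_mean_scaled \<sigma> (D 1 s) (D 1 t)\<bar>
      \<le> 3 / 2 * (M * h ^ 3) + (M\<^sup>2 / c * h ^ 3) / 2"
    using abs_error_combination R(1) hR1 dq by blast
  also have "\<dots> = (3 / 2 * M + M\<^sup>2 / (2 * c)) * h ^ 3"
    by (simp add: algebra_simps)
  finally show ?thesis .
qed

text \<open>The trapezoidal error contributes \<open>- h^3 / 12 * D 3 t\<close> and the correction
  \<open>h^3 / 4 * (D 2 t)^2 * r\<close> to leading order. The hypothesis \<open>flat\<close> states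
  that they cancel.\<close>

lemma truncation_order3:
  assumes k: "4 \<le> k" and ts: "t \<in> {a..b}" "s \<in> {a..b}" and h: "s = t + h" "h \<ge> 0"
    and \<sigma>: "\<sigma> > 0" and c: "c > 0" "c \<le> scaled_hyp \<sigma> (D 1 t)"
    and flat: "D 3 t = 3 * ((D 2 t)\<^sup>2 * (D 1 t / (scaled_hyp \<sigma> (D 1 t))\<^sup>2))"
  shows "\<bar>D 0 s - D 0 t - h * spec_mean_scaled \<sigma> (D 1 s) (D 1 t)\<bar>
    \<le> (3 / 2 * M + M\<^sup>2 / c + 5 / 4 * M ^ 3 / c\<^sup>2) * h ^ 4"
proof -
  define q where "q = (D 1 s + D 1 t) / (scaled_hyp \<sigma> (D 1 s) + scaled_hyp \<sigma> (D 1 t))\<^sup>2"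
  define r where "r = D 1 t / (scaled_hyp \<sigma> (D 1 t))\<^sup>2"
  define d where "d = D 1 s - D 1 t"
  define x where "x = D 2 t"
  define R0 where "R0 = D 0 s - (D 0 t + h * D 1 t + h\<^sup>2 / 2 * D 2 t + h ^ 3 / 6 * D 3 t)"
  define R1 where "R1 = D 1 s - (D 1 t + h * D 2 t + h\<^sup>2 / 2 * D 3 t)"
  have R: "\<bar>R0\<bar> \<le> M * h ^ 4" "\<bar>R1\<bar> \<le> M * h ^ 3"
    using taylor[of 0 3 s t] taylor[of 1 2 s t] k ts h
    by (simp_all add: R0_def R1_def numeral_eq_Suc algebra_simps)
  have hR1: "\<bar>h * R1\<bar> \<le> M * h ^ 4"
    using mult_left_mono[OF R(2) h(2)] h(2) by (simp add: abs_mult power3_eq_cube power4_eq_xxxx mult_ac)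
  have d: "\<bar>d\<bar> \<le> M * h" and x: "\<bar>x\<bar> \<le> M"
    unfolding d_def x_def using increment_bound[of 1 s t] bound[of 2 t] k ts h by auto
  have hx: "\<bar>h * x\<bar> \<le> M * h"
    using mult_left_mono[OF x h(2)] h(2) by (simp add: abs_mult mult.commute)
  have "\<bar>d - h * x\<bar> \<le> M * h\<^sup>2"
    using taylor[of 1 1 s t] k ts h by (simp add: d_def x_def numeral_eq_Suc algebra_simps)
  moreover have "\<bar>d + h * x\<bar> \<le> 2 * (M * h)"
    using d hx by linarith
  ultimately have "\<bar>(d - h * x) * (d + h * x)\<bar> \<le> M * h\<^sup>2 * (2 * (M * h))"
    unfolding abs_mult using M_pos h by (intro mult_mono) auto
  then have sq: "\<bar>d\<^sup>2 - (h * x)\<^sup>2\<bar> \<le> 2 * M\<^sup>2 * h ^ 3"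
    by (simp add: power2_eq_square power3_eq_cube algebra_simps)
  have q: "\<bar>q\<bar> \<le> 1 / c"
    unfolding q_def by (rule correction_factor_bound[OF c])
  have "\<bar>q - r / 2\<bar> \<le> 5 / 2 * \<bar>d\<bar> / c\<^sup>2"
    using correction_factor_left[OF c, of "D 1 s"] by (simp add: q_def r_def d_def mult.commute)
  also have "\<dots> \<le> 5 / 2 * (M * h) / c\<^sup>2"
    using d by (intro divide_right_mono mult_left_mono) auto
  finally have qr: "\<bar>q - r / 2\<bar> \<le> 5 / 2 * (M * h) / c\<^sup>2" .
  have 1: "\<bar>(d\<^sup>2 - (h * x)\<^sup>2) * q\<bar> \<le> 2 * M\<^sup>2 * h ^ 3 * (1 / c)"
    unfolding abs_mult using sq q h by (intro mult_mono) auto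
  have "(h * x)\<^sup>2 \<le> (M * h)\<^sup>2"
    using hx M_pos h by (simp flip: abs_le_square_iff)
  then have 2: "\<bar>(h * x)\<^sup>2 * (q - r / 2)\<bar> \<le> (M * h)\<^sup>2 * (5 / 2 * (M * h) / c\<^sup>2)"
    unfolding abs_mult using qr h by (intro mult_mono) auto
  \<comment> \<open>First \<open>d\<close> is replaced by its linear part \<open>h * x\<close>, then
    \<open>q\<close> by its diagonal value \<open>r / 2\<close>.\<close>
  have "d\<^sup>2 * q - h\<^sup>2 * x\<^sup>2 * r / 2 = (d\<^sup>2 - (h * x)\<^sup>2) * q + (h * x)\<^sup>2 * (q - r / 2)"
    by (simp add: field_simps power2_eq_square)
  then have "\<bar>d\<^sup>2 * q - h\<^sup>2 * x\<^sup>2 * r / 2\<bar>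
      \<le> 2 * M\<^sup>2 * h ^ 3 * (1 / c) + (M * h)\<^sup>2 * (5 / 2 * (M * h) / c\<^sup>2)"
    using 1 2 by linarith
  also have "\<dots> = (2 * M\<^sup>2 / c + 5 / 2 * M ^ 3 / c\<^sup>2) * h ^ 3"
    by (simp add: distrib_right power_mult_distrib power2_eq_square power3_eq_cube)
  finally have "h * \<bar>d\<^sup>2 * q - h\<^sup>2 * x\<^sup>2 * r / 2\<bar> \<le> h * ((2 * M\<^sup>2 / c + 5 / 2 * M ^ 3 / c\<^sup>2) * h ^ 3)"
    using h(2) by (rule mult_left_mono)
  also have "\<dots> = (2 * M\<^sup>2 / c + 5 / 2 * M ^ 3 / c\<^sup>2) * h ^ 4"
    by (simp add: power3_eq_cube power4_eq_xxxx)
  finally have err: "\<bar>h * (d\<^sup>2 * q - h\<^sup>2 * x\<^sup>2 * r / 2)\<bar> \<le> (2 * M\<^sup>2 / c + 5 / 2 * M ^ 3 / c\<^sup>2) * h ^ 4"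
    using h(2) by (simp add: abs_mult)
  have flat': "D 3 t = 3 * (x\<^sup>2 * r)"
    using flat by (simp add: x_def r_def)
  have "D 0 s - D 0 t - h * spec_mean_scaled \<sigma> (D 1 s) (D 1 t)
      = R0 - h * R1 / 2 + h * (d\<^sup>2 * q - h\<^sup>2 * x\<^sup>2 * r / 2) / 2
        + h ^ 3 / 12 * (3 * (x\<^sup>2 * r) - D 3 t)"
    unfolding spec_mean_scaled_eq_trapezoid[OF \<sigma>] q_def[symmetric] d_def[symmetric]
    by (simp add: R0_def R1_def d_def field_simps power2_eq_square power3_eq_cube)
  then have "\<bar>D 0 s - D 0 t - h * spec_mean_scaled \<sigma> (D 1 s) (D 1 t)\<bar>
      \<le> 3 / 2 * (M * h ^ 4) + ((2 * M\<^sup>2 / c + 5 / 2 * M ^ 3 / c\<^sup>2) * h ^ 4) / 2"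
    unfolding flat' using abs_error_combination R(1) hR1 err by (simp only: diff_self mult_zero_right add_0_right)
  also have "\<dots> = (3 / 2 * M + M\<^sup>2 / c + 5 / 4 * M ^ 3 / c\<^sup>2) * h ^ 4"
    by (simp add: algebra_simps)
  finally show ?thesis .
qed

text \<open>Averaging the third-derivative term over both endpoints absorbs the fourth-derivative
  term of the trapezoidal error. The correction is symmetric in the endpoints, so it too agrees with
  its endpoint average up to one order more, and \<open>balanced\<close> cancels the two
  averages.\<close>

lemma truncation_order4:
  assumes k: "5 \<le> k" and ts: "t \<in> {a..b}" "s \<in> {a..b}" and h: "s = t + h" "h \<ge> 0"
    and \<sigma>: "\<sigma> > 0" and c: "c > 0" "c \<le> scaled_hyp \<sigma> (D 1 t)" "c \<le> scaled_hyp \<sigma> (D 1 s)"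
    and balanced: "D 3 t + D 3 s = 3 * ((D 2 t)\<^sup>2 * (D 1 t / (scaled_hyp \<sigma> (D 1 t))\<^sup>2)
      + (D 2 s)\<^sup>2 * (D 1 s / (scaled_hyp \<sigma> (D 1 s))\<^sup>2))"
  shows "\<bar>D 0 s - D 0 t - h * spec_mean_scaled \<sigma> (D 1 s) (D 1 t)\<bar>
    \<le> (2 * M + 2 * M\<^sup>2 / c + M ^ 3 / (8 * c\<^sup>2) + M ^ 4 / (2 * c ^ 3)) * h ^ 5"
proof -
  define q where "q = (D 1 s + D 1 t) / (scaled_hyp \<sigma> (D 1 s) + scaled_hyp \<sigma> (D 1 t))\<^sup>2"
  define r where "r = D 1 t / (scaled_hyp \<sigma> (D 1 t))\<^sup>2"
  define r' where "r' = D 1 s / (scaled_hyp \<sigma> (D 1 s))\<^sup>2"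
  define d where "d = D 1 s - D 1 t"
  define x y where "x = D 2 t" and "y = D 2 s"
  define R0 where "R0 = D 0 s - (D 0 t + h * D 1 t + h\<^sup>2 / 2 * D 2 t + h ^ 3 / 6 * D 3 t
    + h ^ 4 / 24 * D 4 t)"
  define R1 where "R1 = D 1 s - (D 1 t + h * D 2 t + h\<^sup>2 / 2 * D 3 t + h ^ 3 / 6 * D 4 t)"
  define R1' where "R1' = D 1 s - (D 1 t + h * D 2 t + h\<^sup>2 / 2 * D 3 t)"
  define R2 where "R2 = D 2 s - (D 2 t + h * D 3 t)"
  define R3 where "R3 = D 3 s - (D 3 t + h * D 4 t)"
  have R: "\<bar>R0\<bar> \<le> M * h ^ 5" "\<bar>R1\<bar> \<le> M * h ^ 4" "\<bar>R1'\<bar> \<le> M * h ^ 3" "\<bar>R2\<bar> \<le> M * h\<^sup>2" "\<bar>R3\<bar> \<le> M * h\<^sup>2"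
    using taylor[of 0 4 s t] taylor[of 1 3 s t] taylor[of 1 2 s t] taylor[of 2 1 s t]
      taylor[of 3 1 s t] k ts h
    by (simp_all add: R0_def R1_def R1'_def R2_def R3_def numeral_eq_Suc algebra_simps)
  have hR1: "\<bar>h * R1\<bar> \<le> M * h ^ 5"
    using mult_left_mono[OF R(2) h(2)] h(2) by (simp add: abs_mult numeral_eq_Suc mult_ac)
  have hR2: "\<bar>h * R2\<bar> \<le> M * h ^ 3"
    using mult_left_mono[OF R(4) h(2)] h(2) by (simp add: abs_mult numeral_eq_Suc mult_ac)
  have hR3: "\<bar>h ^ 3 * R3\<bar> \<le> M * h ^ 5"
    using mult_left_mono[OF R(5), of "h ^ 3"] h(2) by (simp add: abs_mult numeral_eq_Suc mult_ac)
  have d: "\<bar>d\<bar> \<le> M * h" and xy: "\<bar>x - y\<bar> \<le> M * h" and x: "\<bar>x\<bar> \<le> M" and y: "\<bar>y\<bar> \<le> M"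
    unfolding d_def x_def y_def
    using increment_bound[of 1 s t] increment_bound[of 2 s t] bound[of 2 t] bound[of 2 s] k ts h
    by (auto simp: abs_minus_commute)
  have hxy: "\<bar>h * (x + y) / 2\<bar> \<le> M * h"
  proof -
    have "\<bar>x + y\<bar> \<le> 2 * M"
      using x y by linarith
    from mult_left_mono[OF this h(2)] show ?thesis
      using h(2) by (simp add: abs_mult mult_ac)
  qed
  have q: "\<bar>q\<bar> \<le> 1 / c"
    unfolding q_def by (rule correction_factor_bound[OF c(1,2)])
  have qr: "\<bar>q - (r + r') / 4\<bar> \<le> (M * h)\<^sup>2 / c ^ 3"
  proof -
    have "\<bar>q - (r + r') / 4\<bar> \<le> d\<^sup>2 / c ^ 3"
      using correction_factor_symmetric[OF c(1,3,2)] by (simp add: q_def r_def r'_def d_def add.commute)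
    also have "\<dots> \<le> (M * h)\<^sup>2 / c ^ 3"
      using d c M_pos h by (intro divide_right_mono) (auto simp flip: abs_le_square_iff)
    finally show ?thesis .
  qed
  have rr: "\<bar>r' - r\<bar> \<le> M * h / c\<^sup>2"
    using scaled_ratio_lipschitz[OF c(1,3,2)] divide_right_mono[OF d, of "c\<^sup>2"]
    by (simp add: r_def r'_def d_def)
  have sq: "\<bar>d\<^sup>2 - h\<^sup>2 * (x\<^sup>2 + y\<^sup>2) / 2\<bar> \<le> 4 * M\<^sup>2 * h ^ 4"
  proof -
    \<comment> \<open>This is the trapezoidal defect for \<open>D 1\<close>, of third order. It
      needs the expansion of \<open>D 1\<close> only up to \<open>D 3\<close>, whence
      \<open>R1'\<close> beside \<open>R1\<close>.\<close>
    have "d - h * (x + y) / 2 = R1' - h * R2 / 2"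
      by (simp add: d_def x_def y_def R1'_def R2_def field_simps power2_eq_square)
    then have "\<bar>d - h * (x + y) / 2\<bar> \<le> 3 / 2 * (M * h ^ 3)"
      using R(3) hR2 by linarith
    moreover have "\<bar>d + h * (x + y) / 2\<bar> \<le> 2 * (M * h)"
      using d hxy by linarith
    ultimately have "\<bar>(d - h * (x + y) / 2) * (d + h * (x + y) / 2)\<bar>
        \<le> 3 / 2 * (M * h ^ 3) * (2 * (M * h))"
      unfolding abs_mult using M_pos h by (intro mult_mono) auto
    also have "\<dots> = 3 * (M\<^sup>2 * h ^ 4)"
      by (simp add: numeral_eq_Suc)
    finally have 1: "\<bar>(d - h * (x + y) / 2) * (d + h * (x + y) / 2)\<bar> \<le> 3 * (M\<^sup>2 * h ^ 4)" .
    have "\<bar>(h * (x - y))\<^sup>2\<bar> \<le> (h * (M * h))\<^sup>2"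
    proof -
      have "\<bar>h * (x - y)\<bar> \<le> h * (M * h)"
        using mult_left_mono[OF xy h(2)] h(2) by (simp add: abs_mult)
      then show ?thesis
        using abs_le_square_iff[of "h * (x - y)" "h * (M * h)"] M_pos h(2) by simp
    qed
    also have "\<dots> = M\<^sup>2 * h ^ 4"
      by (simp add: numeral_eq_Suc)
    finally have 2: "\<bar>(h * (x - y))\<^sup>2\<bar> \<le> M\<^sup>2 * h ^ 4" .
    \<comment> \<open>The mean of the squares exceeds the square of the mean by
      \<open>(x - y)^2 / 4\<close>.\<close>
    have "d\<^sup>2 - h\<^sup>2 * (x\<^sup>2 + y\<^sup>2) / 2
        = (d - h * (x + y) / 2) * (d + h * (x + y) / 2) - (h * (x - y))\<^sup>2 / 4"
      by (simp add: field_simps power2_eq_square)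
    moreover have "\<bar>v - w / 4\<bar> \<le> 4 * z" if "\<bar>v\<bar> \<le> 3 * z" "\<bar>w\<bar> \<le> z" for v w z :: real
      using that by linarith
    ultimately show ?thesis
      using 1 2 by (metis mult.assoc)
  qed
  have 1: "\<bar>(d\<^sup>2 - h\<^sup>2 * (x\<^sup>2 + y\<^sup>2) / 2) * q\<bar> \<le> 4 * M\<^sup>2 * h ^ 4 * (1 / c)"
    unfolding abs_mult using sq q by (intro mult_mono) auto
  have "x\<^sup>2 \<le> M\<^sup>2" "y\<^sup>2 \<le> M\<^sup>2"
    using x y M_pos by (simp_all flip: abs_le_square_iff)
  then have "\<bar>(x\<^sup>2 + y\<^sup>2) / 2 * (q - (r + r') / 4)\<bar> \<le> M\<^sup>2 * ((M * h)\<^sup>2 / c ^ 3)"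
    unfolding abs_mult using qr by (intro mult_mono) auto
  from mult_left_mono[OF this, of "h\<^sup>2"]
  have 2: "\<bar>h\<^sup>2 * ((x\<^sup>2 + y\<^sup>2) / 2 * (q - (r + r') / 4))\<bar> \<le> h\<^sup>2 * (M\<^sup>2 * ((M * h)\<^sup>2 / c ^ 3))"
    unfolding abs_mult[of "h\<^sup>2"] by simp
  have "\<bar>(x - y) * (x + y)\<bar> \<le> (M * h) * (2 * M)"
    unfolding abs_mult using x y xy by (intro mult_mono) auto
  then have "\<bar>(x - y) * (x + y) * (r' - r)\<bar> \<le> (M * h) * (2 * M) * (M * h / c\<^sup>2)"
    unfolding abs_mult[of "(x - y) * (x + y)"] using rr M_pos h by (intro mult_mono) auto
  from mult_left_mono[OF this, of "h\<^sup>2"]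
  have 3: "\<bar>h\<^sup>2 * ((x - y) * (x + y) * (r' - r))\<bar> \<le> h\<^sup>2 * ((M * h) * (2 * M) * (M * h / c\<^sup>2))"
    unfolding abs_mult[of "h\<^sup>2"] by simp
  \<comment> \<open>Both factors are replaced by endpoint means. The last summand is the gap between
    the product of means and the mean of products; it is of fourth order as \<open>x - y\<close> and
    \<open>r' - r\<close> are both of order \<open>h\<close>.\<close>
  have "d\<^sup>2 * q - h\<^sup>2 * (x\<^sup>2 * r + y\<^sup>2 * r') / 4 =
      (d\<^sup>2 - h\<^sup>2 * (x\<^sup>2 + y\<^sup>2) / 2) * q + h\<^sup>2 * ((x\<^sup>2 + y\<^sup>2) / 2 * (q - (r + r') / 4))
      + h\<^sup>2 * ((x - y) * (x + y) * (r' - r)) / 8"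
    by (simp add: field_simps power2_eq_square)
  moreover have "\<bar>u + v + w / 8\<bar> \<le> A + B + C / 8"
    if "\<bar>u\<bar> \<le> A" "\<bar>v\<bar> \<le> B" "\<bar>w\<bar> \<le> C" for u v w A B C :: real
    using that by linarith
  ultimately have "\<bar>d\<^sup>2 * q - h\<^sup>2 * (x\<^sup>2 * r + y\<^sup>2 * r') / 4\<bar>
      \<le> 4 * M\<^sup>2 * h ^ 4 * (1 / c) + h\<^sup>2 * (M\<^sup>2 * ((M * h)\<^sup>2 / c ^ 3))
        + h\<^sup>2 * ((M * h) * (2 * M) * (M * h / c\<^sup>2)) / 8"
    using 1 2 3 by (simp only:)
  also have "\<dots> = (4 * M\<^sup>2 / c + M ^ 4 / c ^ 3 + M ^ 3 / (4 * c\<^sup>2)) * h ^ 4"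
    by (simp add: algebra_simps numeral_eq_Suc)
  finally have "h * \<bar>d\<^sup>2 * q - h\<^sup>2 * (x\<^sup>2 * r + y\<^sup>2 * r') / 4\<bar>
      \<le> h * ((4 * M\<^sup>2 / c + M ^ 4 / c ^ 3 + M ^ 3 / (4 * c\<^sup>2)) * h ^ 4)"
    using h(2) by (rule mult_left_mono)
  also have "\<dots> = (4 * M\<^sup>2 / c + M ^ 4 / c ^ 3 + M ^ 3 / (4 * c\<^sup>2)) * h ^ 5"
    by (simp add: numeral_eq_Suc)
  finally have err: "\<bar>h * (d\<^sup>2 * q - h\<^sup>2 * (x\<^sup>2 * r + y\<^sup>2 * r') / 4)\<bar>
      \<le> (4 * M\<^sup>2 / c + M ^ 4 / c ^ 3 + M ^ 3 / (4 * c\<^sup>2)) * h ^ 5"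
    using h(2) by (simp add: abs_mult)
  have balanced': "D 3 t + D 3 s = 3 * (x\<^sup>2 * r + y\<^sup>2 * r')"
    using balanced by (simp add: x_def y_def r_def r'_def)
  have "D 0 s - D 0 t - h * spec_mean_scaled \<sigma> (D 1 s) (D 1 t)
      = R0 + h ^ 3 * R3 / 24 - h * R1 / 2 + h * (d\<^sup>2 * q - h\<^sup>2 * (x\<^sup>2 * r + y\<^sup>2 * r') / 4) / 2
        + h ^ 3 / 24 * (3 * (x\<^sup>2 * r + y\<^sup>2 * r') - (D 3 t + D 3 s))"
    unfolding spec_mean_scaled_eq_trapezoid[OF \<sigma>] q_def[symmetric] d_def[symmetric]
    by (simp add: R0_def R1_def R3_def d_def field_simps power2_eq_square power3_eq_cube power4_eq_xxxx)
  then have "D 0 s - D 0 t - h * spec_mean_scaled \<sigma> (D 1 s) (D 1 t)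
      = R0 + h ^ 3 * R3 / 24 - h * R1 / 2 + h * (d\<^sup>2 * q - h\<^sup>2 * (x\<^sup>2 * r + y\<^sup>2 * r') / 4) / 2"
    unfolding balanced' by (simp only: diff_self mult_zero_right add_0_right)
  moreover have "\<bar>u + v / 24 - w / 2 + z / 2\<bar> \<le> 2 * A + B / 2"
    if "\<bar>u\<bar> \<le> A" "\<bar>v\<bar> \<le> A" "\<bar>w\<bar> \<le> A" "\<bar>z\<bar> \<le> B" for u v w z A B :: real
    using that by linarith
  ultimately have "\<bar>D 0 s - D 0 t - h * spec_mean_scaled \<sigma> (D 1 s) (D 1 t)\<bar>
      \<le> 2 * (M * h ^ 5) + ((4 * M\<^sup>2 / c + M ^ 4 / c ^ 3 + M ^ 3 / (4 * c\<^sup>2)) * h ^ 5) / 2"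
    using R(1) hR3 hR1 err by (simp only:)
  also have "\<dots> = (2 * M + 2 * M\<^sup>2 / c + M ^ 3 / (8 * c\<^sup>2) + M ^ 4 / (2 * c ^ 3)) * h ^ 5"
    by (simp add: algebra_simps)
  finally show ?thesis .
qed

section \<open>Curvature and speed of the scaled curve\<close>

lemma scaled_curvature_eq:
  assumes k: "2 \<le> k" and t: "t \<in> {a..b}" and s: "s > 0"
  shows "scaled_curvature a b (D 0) s t = s\<^sup>2 * D 2 t / scaled_hyp s (D 1 t) ^ 3"
proof -
  have D1: "deriv_on a b (D 0) t = D 1 t" if "t \<in> {a..b}" for t
    using deriv[of 0 t] that k less
    by (intro deriv_on_eqI[where g = "D 0"]) (auto simp: has_real_derivative_iff_has_vector_derivative)
  have "deriv_on a b (deriv_on a b (D 0)) t = D 2 t"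
  proof (rule deriv_on_eqI[OF less t D1])
    show "(D 1 has_vector_derivative D 2 t) (at t within {a..b})"
      using deriv[of 1 t] t k
      by (simp add: has_real_derivative_iff_has_vector_derivative numeral_2_eq_2)
  qed
  moreover have "x powr (3 / 2) = sqrt x ^ 3" if "x > 0" for x :: real
  proof -
    have "x powr (3 / 2) = x powr (1 + 1 / 2)"
      by simp
    also have "\<dots> = sqrt x ^ 3"
      using that by (simp only: powr_add powr_half_sqrt) (simp add: power3_eq_cube)
    finally show ?thesis .
  qed
  moreover have "s\<^sup>2 + (D 1 t)\<^sup>2 > 0"
    using s by (simp add: add_pos_nonneg)
  ultimately show ?thesis
    by (simp add: scaled_curvature_def scaled_hyp_def D1[OF t])
qed

text \<open>By the quotient rule the bracket is the leading coefficient of the local error. Its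
  prefactor is positive, so the bracket vanishes exactly when the derivative of the curvature
  does.\<close>

lemma deriv_on_scaled_curvature:
  assumes k: "3 \<le> k" and t: "t \<in> {a..b}" and s: "s > 0"
  shows "deriv_on a b (scaled_curvature a b (D 0) s) t =
    s\<^sup>2 * (D 3 t - 3 * ((D 2 t)\<^sup>2 * (D 1 t / (scaled_hyp s (D 1 t))\<^sup>2))) / scaled_hyp s (D 1 t) ^ 3"
proof -
  define A where "A \<tau> = scaled_hyp s (D 1 \<tau>)" for \<tau>
  have A_pos: "A \<tau> > 0" for \<tau>
    using s by (simp add: A_def scaled_hyp_pos)
  have pos: "s\<^sup>2 + x\<^sup>2 > 0" for x :: real
    using s by (simp add: add_pos_nonneg)
  have D1: "(D 1 has_real_derivative D 2 t) (at t within {a..b})"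
    and D2: "(D 2 has_real_derivative D 3 t) (at t within {a..b})"
    using deriv[of 1 t] deriv[of 2 t] k t by (auto simp: numeral_eq_Suc)
  have "(A has_real_derivative D 1 t * D 2 t / A t) (at t within {a..b})"
    unfolding A_def scaled_hyp_def
    using pos[of "D 1 t"] by (auto intro!: derivative_eq_intros D1[simplified] simp: divide_simps)
  then have "((\<lambda>\<tau>. s\<^sup>2 * D 2 \<tau> / A \<tau> ^ 3) has_real_derivative
      (s\<^sup>2 * D 3 t * A t ^ 3 - s\<^sup>2 * D 2 t * (3 * (A t)\<^sup>2 * (D 1 t * D 2 t / A t))) / (A t ^ 3 * A t ^ 3))
      (at t within {a..b})"
    using A_pos[of t] by (auto intro!: derivative_eq_intros D2)
  also have "(s\<^sup>2 * D 3 t * A t ^ 3 - s\<^sup>2 * D 2 t * (3 * (A t)\<^sup>2 * (D 1 t * D 2 t / A t))) / (A t ^ 3 * A t ^ 3)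
      = s\<^sup>2 * (D 3 t - 3 * ((D 2 t)\<^sup>2 * (D 1 t / (A t)\<^sup>2))) / A t ^ 3"
    using A_pos[of t] by (simp add: field_simps power2_eq_square power3_eq_cube)
  finally show ?thesis
    unfolding A_def using t k s less
    by (intro deriv_on_eqI[where g = "\<lambda>\<tau>. s\<^sup>2 * D 2 \<tau> / scaled_hyp s (D 1 \<tau>) ^ 3"])
      (auto simp: has_real_derivative_iff_has_vector_derivative scaled_curvature_eq)
qed

text \<open>The cube of this speed cancels the cubed hypotenuse in the derivative of the
  curvature.\<close>

lemma norm_deriv_on_scaled_curve:
  assumes k: "1 \<le> k" and t: "t \<in> {a..b}" and s: "s > 0"
  shows "norm (deriv_on a b (scaled_curve (D 0) s) t) = scaled_hyp s (D 1 t) / s"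
proof -
  have "(D 0 has_vector_derivative D 1 t) (at t within {a..b})"
    using deriv[of 0 t] k t by (simp add: has_real_derivative_iff_has_vector_derivative)
  then have "((\<lambda>\<tau>. (\<tau>, D 0 \<tau> / s)) has_vector_derivative (1, D 1 t / s)) (at t within {a..b})"
    by (intro has_vector_derivative_Pair has_vector_derivative_id has_vector_derivative_divide)
  then have "deriv_on a b (scaled_curve (D 0) s) t = (1, D 1 t / s)"
    using t less by (intro deriv_on_eqI) (auto simp: scaled_curve_def)
  moreover have "1 + (D 1 t / s)\<^sup>2 = (s\<^sup>2 + (D 1 t)\<^sup>2) / s\<^sup>2"
    using s by (simp add: field_simps)
  ultimately have "norm (deriv_on a b (scaled_curve (D 0) s) t) = sqrt ((s\<^sup>2 + (D 1 t)\<^sup>2) / s\<^sup>2)"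
    by (simp add: norm_Pair power_divide)
  then show ?thesis
    using s by (simp add: scaled_hyp_def real_sqrt_divide)
qed

end

subsection \<open>Convergence orders\<close>

text \<open>The equation is given on the open interval, but the grid contains \<open>t0\<close> and
  may contain \<open>T\<close>. Both sides are continuous on the closed interval, so the identity
  extends to the endpoints.\<close>

lemma ivp_solution_deriv:
  assumes u: "ivp_solution F \<Omega> t0 T u0 u" and F: "continuous_on \<Omega> F"
    and D: "bounded_derivs t0 T k D M" "D 0 = u" and k: "2 \<le> k" and t: "t \<in> {t0..T}"
  shows "F (t, u t) = D 1 t"
proof -
  interpret bounded_derivs t0 T k D M by fact
  have "continuous_on {t0..T} (D 1)"
    using deriv[of 1] k by (intro DERIV_continuous_on[where D = "D 2"]) (auto simp: numeral_2_eq_2)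
  moreover have "continuous_on {t0..T} (\<lambda>t. F (t, u t))"
    using u by (intro continuous_on_compose2[OF F] continuous_intros) (auto simp: ivp_solution_def)
  ultimately have cont: "continuous_on (closure {t0<..<T}) (\<lambda>t. F (t, u t) - D 1 t)"
    using less by (simp add: closure_greaterThanLessThan continuous_on_diff)
  have "F (s, u s) - D 1 s = 0" if s: "s \<in> {t0<..<T}" for s
  proof -
    have "(u has_real_derivative D 1 s) (at s within {t0..T})"
      using deriv[of 0 s] k D(2) s by simp
    moreover have "at s within {t0..T} = at s"
      using s by (intro at_within_interior) (simp add: interior_atLeastAtMost_real)
    moreover have "(u has_real_derivative F (s, u s)) (at s)"
      using u s by (simp add: ivp_solution_def)
    ultimately show ?thesis
      using DERIV_unique by fastforce
  qed
  from continuous_constant_on_closure[OF cont this] show ?thesis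
    using t less by (simp add: closure_greaterThanLessThan)
qed

theorem corollary4p5:
  fixes \<Omega> :: "(real \<times> real) set" and F :: "real \<times> real \<Rightarrow> real"
    and t0 T u0 \<rho> L H \<eta> :: real and u :: "real \<Rightarrow> real" and \<sigma> :: "real \<Rightarrow> nat \<Rightarrow> real"
  assumes "open \<Omega>" and "t0 \<ge> 0" and "T > t0" and "(t0, u0) \<in> \<Omega>"
    and "Ck_on 2 F \<Omega>"
    and "ivp_solution F \<Omega> t0 T u0 u"
    and "\<And>v. ivp_solution F \<Omega> t0 T u0 v \<Longrightarrow> \<forall>t\<in>{t0..T}. v t = u t"
    and "\<rho> > 0" and "L \<ge> 0" and "tube t0 T u \<rho> \<subseteq> \<Omega>"
    and "\<And>t x y. (t, x) \<in> tube t0 T u \<rho> \<Longrightarrow> (t, y) \<in> tube t0 T u \<rho> \<Longrightarrow>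
           \<bar>F (t, x) - F (t, y)\<bar> \<le> L * \<bar>x - y\<bar>"
    and "H > 0" and "\<eta> > 0"
    and "\<And>h n. h \<in> {0<..H} \<Longrightarrow> n < num_steps t0 T h \<Longrightarrow> \<sigma> h n > 0"
    and "\<And>h n. h \<in> {0<..H} \<Longrightarrow> n < num_steps t0 T h \<Longrightarrow>
           (\<sigma> h n)\<^sup>2 + (deriv_on t0 T u (grid t0 h n))\<^sup>2 \<ge> \<eta>"
  shows "(Ck_on 3 u {t0..T} \<longrightarrow> SE_convergence_order F t0 T u \<rho> H \<sigma> 2) \<and>
    (Ck_on 4 u {t0..T} \<and>
       (\<forall>h\<in>{0<..H}. \<forall>n. grid t0 h (Suc n) \<le> T \<longrightarrow>
          deriv_on t0 T (scaled_curvature t0 T u (\<sigma> h n)) (grid t0 h n) = 0)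
     \<longrightarrow> SE_convergence_order F t0 T u \<rho> H \<sigma> 3) \<and>
    (Ck_on 5 u {t0..T} \<and>
       (\<forall>h\<in>{0<..H}. \<forall>n. grid t0 h (Suc n) \<le> T \<longrightarrow>
          norm (deriv_on t0 T (scaled_curve u (\<sigma> h n)) (grid t0 h n)) ^ 3
            * deriv_on t0 T (scaled_curvature t0 T u (\<sigma> h n)) (grid t0 h n)
          + norm (deriv_on t0 T (scaled_curve u (\<sigma> h n)) (grid t0 h (Suc n))) ^ 3
            * deriv_on t0 T (scaled_curvature t0 T u (\<sigma> h n)) (grid t0 h (Suc n)) = 0)
     \<longrightarrow> SE_convergence_order F t0 T u \<rho> H \<sigma> 4)"
proof -
  note T = \<open>T > t0\<close> and H = \<open>H > 0\<close> and \<rho> = \<open>\<rho> > 0\<close> and L = \<open>L \<ge> 0\<close>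
  note lip = assms(11) and \<sigma>_pos = assms(14) and \<sigma>_lower = assms(15)
  have F: "continuous_on \<Omega> F"
    using \<open>Ck_on 2 F \<Omega>\<close> by (simp add: numeral_2_eq_2 differentiable_imp_continuous_on)
  have grid: "grid t0 h n \<in> {t0..T}" "grid t0 h (Suc n) \<in> {t0..T}" "grid t0 h (Suc n) \<le> T"
    if h: "h \<in> {0<..H}" and n: "n < num_steps t0 T h" for h n
  proof -
    have h_pos: "h > 0"
      using h by simp
    show "grid t0 h (Suc n) \<le> T"
      using n T le_num_steps_iff[OF h_pos, of t0 T "Suc n"] by simp
    moreover have "t0 \<le> grid t0 h n"
      using h_pos by (simp add: grid_def)
    ultimately show "grid t0 h n \<in> {t0..T}" "grid t0 h (Suc n) \<in> {t0..T}"
      using h_pos by (auto simp: grid_Suc)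
  qed
  \<comment> \<open>Along the solution \<open>F\<close> is \<open>D 1\<close>, so all three claims
    reduce to estimates of the local error in terms of the derivatives of \<open>u\<close>.\<close>
  have order: "SE_convergence_order F t0 T u \<rho> H \<sigma> p"
    if D: "bounded_derivs t0 T k D M" "D 0 = u" and k: "2 \<le> k" and p: "p > 0" and "h1 > 0" "K \<ge> 0"
      and step: "\<And>h n. h \<in> {0<..H} \<Longrightarrow> h \<le> h1 \<Longrightarrow> n < num_steps t0 T h \<Longrightarrow>
        \<bar>D 0 (grid t0 h (Suc n)) - D 0 (grid t0 h n)
          - h * spec_mean_scaled (\<sigma> h n) (D 1 (grid t0 h (Suc n))) (D 1 (grid t0 h n))\<bar> \<le> K * h ^ Suc p"
    for k D M p h1 K
    using step grid
    by (intro SE_convergence_order_if_consistent[OF T p \<rho> L H lip \<sigma>_pos \<open>h1 > 0\<close> \<open>K \<ge> 0\<close>])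
      (simp_all add: ivp_solution_deriv[OF assms(6) F D k] D(2))
  \<comment> \<open>A lower bound for all hypotenuses at left grid points, uniform in the step size
    and the scales.\<close>
  define c where "c = sqrt \<eta>"
  have c: "c > 0"
    using \<open>\<eta> > 0\<close> by (simp add: c_def)
  have c_le: "c \<le> scaled_hyp (\<sigma> h n) (D 1 (grid t0 h n))"
    if D: "bounded_derivs t0 T k D M" "D 0 = u" and k: "1 \<le> k"
      and hn: "h \<in> {0<..H}" "n < num_steps t0 T h" for k D M h n
  proof -
    interpret bounded_derivs t0 T k D M by fact
    have "deriv_on t0 T u (grid t0 h n) = D 1 (grid t0 h n)"
      using deriv[of 0 "grid t0 h n"] grid(1)[OF hn] D(2) k
      by (intro deriv_on_eqI[OF T grid(1)[OF hn] refl])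
        (simp add: has_real_derivative_iff_has_vector_derivative)
    then show ?thesis
      using \<sigma>_lower[OF hn] by (simp add: c_def scaled_hyp_def)
  qed
  show ?thesis
  proof (intro conjI impI; (elim conjE)?)
    assume "Ck_on 3 u {t0..T}"
    then obtain D M where D: "bounded_derivs t0 T 3 D M" "D 0 = u"
      using Ck_on_Icc_imp_bounded_derivs[OF T] by blast
    interpret bounded_derivs t0 T 3 D M by fact
    show "SE_convergence_order F t0 T u \<rho> H \<sigma> 2"
    proof (rule order[OF D _ _ zero_less_one])
      fix h n assume hn: "h \<in> {0<..H}" "n < num_steps t0 T h"
      show "\<bar>D 0 (grid t0 h (Suc n)) - D 0 (grid t0 h n)
          - h * spec_mean_scaled (\<sigma> h n) (D 1 (grid t0 h (Suc n))) (D 1 (grid t0 h n))\<bar>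
        \<le> (3 / 2 * M + M\<^sup>2 / (2 * c)) * h ^ Suc 2"
        using truncation_order2[OF _ grid(1,2)[OF hn] grid_Suc _ \<sigma>_pos[OF hn] c c_le[OF D _ hn]] hn
        by simp
    qed (use M_pos c in auto)
  next
    assume "Ck_on 4 u {t0..T}"
      and flat: "\<forall>h\<in>{0<..H}. \<forall>n. grid t0 h (Suc n) \<le> T \<longrightarrow>
          deriv_on t0 T (scaled_curvature t0 T u (\<sigma> h n)) (grid t0 h n) = 0"
    then obtain D M where D: "bounded_derivs t0 T 4 D M" "D 0 = u"
      using Ck_on_Icc_imp_bounded_derivs[OF T] by blast
    interpret bounded_derivs t0 T 4 D M by fact
    show "SE_convergence_order F t0 T u \<rho> H \<sigma> 3"
    proof (rule order[OF D _ _ zero_less_one])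
      fix h n assume hn: "h \<in> {0<..H}" "n < num_steps t0 T h"
      have "deriv_on t0 T (scaled_curvature t0 T (D 0) (\<sigma> h n)) (grid t0 h n) = 0"
        using flat hn grid(3)[OF hn] D(2) by simp
      then have "D 3 (grid t0 h n) = 3 * ((D 2 (grid t0 h n))\<^sup>2
          * (D 1 (grid t0 h n) / (scaled_hyp (\<sigma> h n) (D 1 (grid t0 h n)))\<^sup>2))"
        using \<sigma>_pos[OF hn] scaled_hyp_pos[OF \<sigma>_pos[OF hn], of "D 1 (grid t0 h n)"]
        by (subst (asm) deriv_on_scaled_curvature[OF _ grid(1)[OF hn]]) simp_all
      then show "\<bar>D 0 (grid t0 h (Suc n)) - D 0 (grid t0 h n)
          - h * spec_mean_scaled (\<sigma> h n) (D 1 (grid t0 h (Suc n))) (D 1 (grid t0 h n))\<bar>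
        \<le> (3 / 2 * M + M\<^sup>2 / c + 5 / 4 * M ^ 3 / c\<^sup>2) * h ^ Suc 3"
        using truncation_order3[OF _ grid(1,2)[OF hn] grid_Suc _ \<sigma>_pos[OF hn] c c_le[OF D _ hn]] hn
        by simp
    qed (use M_pos c in auto)
  next
    assume "Ck_on 5 u {t0..T}"
      and balanced: "\<forall>h\<in>{0<..H}. \<forall>n. grid t0 h (Suc n) \<le> T \<longrightarrow>
          norm (deriv_on t0 T (scaled_curve u (\<sigma> h n)) (grid t0 h n)) ^ 3
            * deriv_on t0 T (scaled_curvature t0 T u (\<sigma> h n)) (grid t0 h n)
          + norm (deriv_on t0 T (scaled_curve u (\<sigma> h n)) (grid t0 h (Suc n))) ^ 3
            * deriv_on t0 T (scaled_curvature t0 T u (\<sigma> h n)) (grid t0 h (Suc n)) = 0"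
    then obtain D M where D: "bounded_derivs t0 T 5 D M" "D 0 = u"
      using Ck_on_Icc_imp_bounded_derivs[OF T] by blast
    interpret bounded_derivs t0 T 5 D M by fact
    \<comment> \<open>The lower bound pairs \<open>\<sigma> h n\<close> with the left grid point
      only. For \<open>h \<le> e / M\<close> the slope, and with it the hypotenuse, changes by at
      most \<open>e\<close> over a step, so \<open>c - e = e\<close> remains at the right grid
      point.\<close>
    define e where "e = c / 2"
    have e: "e > 0"
      using c by (simp add: e_def)
    show "SE_convergence_order F t0 T u \<rho> H \<sigma> 4"
    proof (rule order[OF D])
      fix h n assume hn: "h \<in> {0<..H}" "n < num_steps t0 T h" and small: "h \<le> e / M"
      define s t t' where "s = \<sigma> h n" and "t = grid t0 h n" and "t' = grid t0 h (Suc n)"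
      have s: "s > 0"
        using \<sigma>_pos[OF hn] by (simp add: s_def)
      have t: "t \<in> {t0..T}" "t' \<in> {t0..T}" "t' = t + h" and h: "h \<ge> 0"
        using grid[OF hn] hn by (simp_all add: t_def t'_def grid_Suc)
      have "\<bar>D 1 t' - D 1 t\<bar> \<le> M * h"
        using increment_bound[of 1 t' t] t h by simp
      also have "M * h \<le> e"
        using small M_pos by (simp add: field_simps)
      finally have "\<bar>scaled_hyp s (D 1 t') - scaled_hyp s (D 1 t)\<bar> \<le> e"
        using scaled_hyp_lipschitz[of s "D 1 t'" "D 1 t"] by linarith
      then have e_le: "e \<le> scaled_hyp s (D 1 t)" "e \<le> scaled_hyp s (D 1 t')"
        using c_le[OF D _ hn, folded s_def t_def] c unfolding e_def by linarith+
      \<comment> \<open>Both endpoints share the scale \<open>s\<close>, so the remaining factor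
        \<open>1 / s\<close> is common and the curvature condition becomes the
        \<open>balanced\<close> identity of the fourth-order estimate.\<close>
      have factor: "norm (deriv_on t0 T (scaled_curve (D 0) s) \<tau>) ^ 3
            * deriv_on t0 T (scaled_curvature t0 T (D 0) s) \<tau>
          = (D 3 \<tau> - 3 * ((D 2 \<tau>)\<^sup>2 * (D 1 \<tau> / (scaled_hyp s (D 1 \<tau>))\<^sup>2))) / s"
        if "\<tau> \<in> {t0..T}" for \<tau>
        using s scaled_hyp_pos[OF s, of "D 1 \<tau>"] norm_deriv_on_scaled_curve[OF _ that s]
          deriv_on_scaled_curvature[OF _ that s]
        by (simp add: power_divide power2_eq_square power3_eq_cube)
      have "(D 3 t - 3 * ((D 2 t)\<^sup>2 * (D 1 t / (scaled_hyp s (D 1 t))\<^sup>2))) / s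
          + (D 3 t' - 3 * ((D 2 t')\<^sup>2 * (D 1 t' / (scaled_hyp s (D 1 t'))\<^sup>2))) / s = 0"
        unfolding factor[OF t(1), symmetric] factor[OF t(2), symmetric]
        using balanced hn grid(3)[OF hn] D(2) by (simp add: s_def t_def t'_def)
      then have "D 3 t + D 3 t' = 3 * ((D 2 t)\<^sup>2 * (D 1 t / (scaled_hyp s (D 1 t))\<^sup>2)
          + (D 2 t')\<^sup>2 * (D 1 t' / (scaled_hyp s (D 1 t'))\<^sup>2))"
        using s unfolding add_divide_distrib[symmetric] by simp
      from truncation_order4[OF _ t h s e e_le this]
      show "\<bar>D 0 (grid t0 h (Suc n)) - D 0 (grid t0 h n)
          - h * spec_mean_scaled (\<sigma> h n) (D 1 (grid t0 h (Suc n))) (D 1 (grid t0 h n))\<bar>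
        \<le> (2 * M + 2 * M\<^sup>2 / e + M ^ 3 / (8 * e\<^sup>2) + M ^ 4 / (2 * e ^ 3)) * h ^ Suc 4"
        by (simp add: s_def t_def t'_def)
    qed (use M_pos e in auto)
  qed
qed

end
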